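(* Let $\mathcal H_{\mathbb R}$ be a real Hilbert space with complexification $\mathcal H$, and let $q\ne0$ be real. Define $R:\mathcal{TP}(\mathcal H_{\mathbb R})\to\mathcal{TP}(\mathcal H_{\mathbb R})$ by the linear extension of $R(\alpha\otimes F)=(-1)^{|\alpha|}\alpha\otimes F$, so that $R(W(\alpha\otimes F))=(-1)^{|\alpha|}W(\alpha\otimes F)$. Then: (i) $T^{(-q)}(R(\alpha\otimes F))=R(T^{(q)}(\alpha\otimes F))$ for all $\alpha\in S_0(n)$, $F\in\mathcal H_{\mathbb R}^{\odot n}$. (ii) $R$ is a $*$-isomorphism from $(\mathcal{TP}(\mathcal H_{\mathbb R}),\cdot_q)$ to $(\mathcal{TP}(\mathcal H_{\mathbb R}),\cdot_{-q})$. (iii) For $\alpha\in S_0(2n)$ and $F\in\mathcal H_{\mathbb R}^{\odot 2n}$, $\varphi_{-q}[R(T^{(q)}(\alpha\otimes F))]=\varphi_q[T^{(q)}(\alpha\otimes F)]$. (iv) For $q=1/N$, $N\in\mathbb N$, $R$ induces an isometry from $\mathcal F_{1/N}(\mathcal H)$ onto $\mathcal F_{-1/N}(\mathcal H)$.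
   Context: Permutations. $[n]=\{1,\dots,n\}$, $[0,n]=\{0,\dots,n\}$; $S(n)$, $S_0(n)$ are the permutation groups of $[n]$, $[0,n]$, with $S(n)\subset S_0(n)$ the permutations fixing $0$; products are composed right to left; for $m>n$, $S_0(n)\subset S_0(m)$ by fixing $n+1,\dots,m$. $\mathrm{cyc}_0(\alpha)$ is the number of cycles of $\alpha\in S_0(n)$ (fixed points are cycles) not containing $0$; $|\alpha|=n-\mathrm{cyc}_0(\alpha)$; $\chi_q$ is the linear extension of $\chi_q(\alpha)=q^{|\alpha|}$. For $\alpha\in S_0(n)$, $\beta\in S_0(k)$, $\alpha\cup\beta=\beta'\alpha\in S_0(n+k)$, where $\beta'$ fixes $[n]$ and is obtained from $\beta$ by replacing each $j\in[k]$ by $n+j$ ($0$ unchanged). Contractions. $\mathcal P_{1,2}(n)$ is the set of partitions $\pi$ of $[n]$ into blocks of size 1 and 2, identified with the involution swapping the elements of each pair; $|\pi|$ is the number of pairs, $\mathrm{supp}(\pi)$ their union. For $S\subset[n]$, $\alpha|_{S^c}$ is the permutation of $[0,n]\setminus S$, $x\mapsto\alpha^m(x)$, $m=\min\{j>0:\alpha^j(x)\notin S\}$. For $\ell=|\pi|$, $$C^{(q)}_\pi(\alpha)=q^{\mathrm{cyc}_0((\pi\alpha)|_{\mathrm{supp}(\pi)^c})-\mathrm{cyc}_0(\pi\alpha)+\ell}\;P\big((\pi\alpha)|_{\mathrm{supp}(\pi)^c}\big)\in\mathbb C[S_0(n-2\ell)],$$ where $P$ relabels $[0,n]\setminus\mathrm{supp}(\pi)$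 by $[0,n-2\ell]$ in the order-preserving way. $C_\pi(h_1\otimes\dots\otimes h_n)=\prod_{\{i,j\}\text{ pair of }\pi}\langle h_i,h_j\rangle\bigotimes_{k\text{ singleton}}h_k$ (increasing order). Algebra. $\mathcal H_{\mathbb R}^{\odot n}$, $\mathcal H^{\otimes n}$ are algebraic, respectively Hilbert, tensor powers. $U_\sigma(h_1\otimes\dots\otimes h_n)=h_{\sigma^{-1}(1)}\otimes\dots\otimes h_{\sigma^{-1}(n)}$, $\alpha\otimes_sF=\frac1{n!}\sum_{\sigma\in S(n)}\sigma\alpha\sigma^{-1}\otimes U_\sigma F$. $\mathcal{TP}(\mathcal H_{\mathbb R})=\bigoplus_{n\ge0}\mathbb C[S_0(n)]\otimes_s\mathcal H_{\mathbb R}^{\odot n}$ (complex span of $\alpha\otimes_sF$; $\alpha\otimes F$ stands for its image $\alpha\otimes_sF$); the element corresponding to $\xi$ is written $W(\xi)$. $T^{(q)}(\alpha\otimes F)=\sum_{\pi\in\mathcal P_{1,2}(n)}W(C_\pi^{(q)}(\alpha)\otimes C_\pi(F))$. The multiplication $\cdot_q$ is defined by $T^{(q)}(\alpha\otimes_sF)\cdot_qT^{(q)}(\beta\otimes_sG)=T^{(q)}((\alpha\cup\beta)\otimes_s(F\otimes G))$, and the adjoint is the antilinear extension of $T^{(q)}(\alpha\otimes_sF)^*=T^{(q)}(\alpha^{-1}\otimes_sF)$. $\varphi_q$ is the linear functional with $\varphi_q[W((0))]=1$, $(0)$ the identity of $S_0(0)$, and $\varphi_q[W(\alpha\otimes F)]=0$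 for $n\ge1$. Fock space. For $q=\pm1/N$, $\langle\alpha\otimes F,\beta\otimes G\rangle_q=\delta_{n=k}\sum_{\sigma\in S(n)}\chi_q(\alpha\sigma\beta^{-1}\sigma^{-1})\langle F,U_\sigma G\rangle$ is a positive semi-definite sesquilinear form on $\bigoplus_n\mathbb C[S_0(n)]\otimes_s\mathcal H^{\otimes n}$; $\mathcal F_q(\mathcal H)$ is the Hilbert space completion of the quotient by its kernel, and $R$ acts on it via $\alpha\otimes F\mapsto(-1)^{|\alpha|}\alpha\otimes F$. *)

theory Defs
  imports
    "HOL-Analysis.Analysis"
    "HOL-Combinatorics.Orbits"
    "HOL-Library.Function_Algebras"
begin

section \<open>Permutations\<close>

text \<open>Permutations are total functions on \<^typ>\<open>nat\<close> that fix everything outside their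
  domain, so the inclusions of \<open>S(n)\<close> in \<open>S\<^sub>0(n)\<close> and of \<open>S\<^sub>0(n)\<close> in \<open>S\<^sub>0(m)\<close> are literal.\<close>

definition Sym0 :: "nat \<Rightarrow> (nat \<Rightarrow> nat) set" where
  "Sym0 n = {\<alpha>. \<alpha> permutes {0..n}}"

definition Sym1 :: "nat \<Rightarrow> (nat \<Rightarrow> nat) set" where
  "Sym1 n = {\<sigma>. \<sigma> permutes {1..n}}"

text \<open>Number of cycles not containing \<open>0\<close> of a permutation \<open>\<alpha>\<close> of the finite set \<open>A\<close>.\<close>

definition cyc0 :: "nat set \<Rightarrow> (nat \<Rightarrow> nat) \<Rightarrow> nat" where
  "cyc0 A \<alpha> = card {orbit \<alpha> x |x. x \<in> A \<and> 0 \<notin> orbit \<alpha> x}"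

definition plen :: "nat \<Rightarrow> (nat \<Rightarrow> nat) \<Rightarrow> nat" where
  "plen n \<alpha> = n - cyc0 {0..n} \<alpha>"

definition chi :: "real \<Rightarrow> nat \<Rightarrow> (nat \<Rightarrow> nat) \<Rightarrow> real" where
  "chi q n \<alpha> = q ^ plen n \<alpha>"

definition shift_perm :: "nat \<Rightarrow> (nat \<Rightarrow> nat) \<Rightarrow> nat \<Rightarrow> nat" where
  "shift_perm n \<beta> x =
    (if x \<in> {1..n} then x
     else let y = \<beta> (if x = 0 then 0 else x - n) in if y = 0 then 0 else n + y)"

definition perm_cup :: "nat \<Rightarrow> (nat \<Rightarrow> nat) \<Rightarrow> (nat \<Rightarrow> nat) \<Rightarrow> nat \<Rightarrow> nat" where
  "perm_cup n \<alpha> \<beta> = shift_perm n \<beta> \<circ> \<alpha>"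

text \<open>Partitions of \<open>[n]\<close> into blocks of size \<open>1\<close> and \<open>2\<close>, as involutions.\<close>

definition P12 :: "nat \<Rightarrow> (nat \<Rightarrow> nat) set" where
  "P12 n = {\<pi>. \<pi> permutes {1..n} \<and> \<pi> \<circ> \<pi> = id}"

definition psupp :: "(nat \<Rightarrow> nat) \<Rightarrow> nat set" where
  "psupp \<pi> = {i. \<pi> i \<noteq> i}"

definition npairs :: "(nat \<Rightarrow> nat) \<Rightarrow> nat" where
  "npairs \<pi> = card {i. i < \<pi> i}"

definition restrict_perm :: "nat set \<Rightarrow> (nat \<Rightarrow> nat) \<Rightarrow> nat \<Rightarrow> nat" where
  "restrict_perm S \<alpha> x =
    (if x \<in> S then x else (\<alpha> ^^ (LEAST j. 0 < j \<and> (\<alpha> ^^ j) x \<notin> S)) x)"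

text \<open>\<^term>\<open>enumerate (- S)\<close> lists the complement of the finite set \<open>S\<close> increasingly, starting
  with index \<open>0\<close>. For \<open>S \<subseteq> [n]\<close> with \<open>r\<close> elements it is the order-preserving bijection from
  \<open>[0, n - r]\<close> to \<open>[0, n] - S\<close>, and it adds \<open>r\<close> to every number beyond \<open>n - r\<close>.\<close>

definition relabel :: "nat set \<Rightarrow> (nat \<Rightarrow> nat) \<Rightarrow> nat \<Rightarrow> nat" where
  "relabel S \<beta> = inv (enumerate (- S)) \<circ> \<beta> \<circ> enumerate (- S)"

text \<open>\<open>C\<^sub>\<pi>\<^sup>(\<^sup>q\<^sup>)(\<alpha>)\<close> is the multiple \<open>contr_coeff q n \<pi> \<alpha>\<close> of the permutation
  \<open>contr_perm \<pi> \<alpha>\<close>. The exponent of \<open>q\<close> can be negative.\<close>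

definition contr_perm :: "(nat \<Rightarrow> nat) \<Rightarrow> (nat \<Rightarrow> nat) \<Rightarrow> nat \<Rightarrow> nat" where
  "contr_perm \<pi> \<alpha> = relabel (psupp \<pi>) (restrict_perm (psupp \<pi>) (\<pi> \<circ> \<alpha>))"

definition contr_coeff :: "real \<Rightarrow> nat \<Rightarrow> (nat \<Rightarrow> nat) \<Rightarrow> (nat \<Rightarrow> nat) \<Rightarrow> real" where
  "contr_coeff q n \<pi> \<alpha> =
    q powi (int (cyc0 ({0..n} - psupp \<pi>) (restrict_perm (psupp \<pi>) (\<pi> \<circ> \<alpha>)))
            - int (cyc0 {0..n} (\<pi> \<circ> \<alpha>)) + int (npairs \<pi>))"

section \<open>Tensor powers\<close>

text \<open>The real Hilbert space is the type \<open>'h\<close>. An \<open>n\<close>-tensor over its complexification is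
  represented by the complex-valued, real-multilinear form on \<open>'h\<^sup>n\<close> (extended by \<open>0\<close> to lists of
  other lengths) for which \<open>h\<^sub>1 \<otimes> \<dots> \<otimes> h\<^sub>n\<close> is \<open>(x\<^sub>1, \<dots>, x\<^sub>n) \<mapsto> \<Prod>\<^sub>i \<langle>h\<^sub>i, x\<^sub>i\<rangle>\<close>; this representation
  is faithful, because the inner product separates points.\<close>

type_synonym 'h tensor = "'h list \<Rightarrow> complex"

definition tscale :: "complex \<Rightarrow> 'h tensor \<Rightarrow> 'h tensor" where
  "tscale c F = (\<lambda>xs. c * F xs)"

definition simple_tensor :: "'h::real_inner list \<Rightarrow> 'h tensor" where
  "simple_tensor hs = (\<lambda>xs. if length xs = length hs
      then complex_of_real (\<Prod>i<length hs. inner (hs ! i) (xs ! i)) else 0)"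

global_interpretation ctens: vector_space tscale
  by unfold_locales (intro ext, simp add: tscale_def distrib_left distrib_right mult.assoc)+

global_interpretation rtens: vector_space "\<lambda>r::real. tscale (complex_of_real r)"
  by unfold_locales (intro ext, simp add: tscale_def distrib_left distrib_right mult.assoc)+

text \<open>The algebraic tensor power of the real space, and its complexification.\<close>

definition ralg_tensors :: "nat \<Rightarrow> 'h::real_inner tensor set" where
  "ralg_tensors n = rtens.span (simple_tensor ` {hs. length hs = n})"

definition calg_tensors :: "nat \<Rightarrow> 'h::real_inner tensor set" where
  "calg_tensors n = ctens.span (simple_tensor ` {hs. length hs = n})"

text \<open>The Hilbert space tensor power: bounded multilinear Hilbert--Schmidt forms. An
  orthonormal basis exists because \<open>'h\<close> is complete, and neither the Hilbert--Schmidt property nor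
  the inner product depends on its choice.
  Inner products are antilinear in the first argument.\<close>

definition is_onb :: "'h::real_inner set \<Rightarrow> bool" where
  "is_onb B \<longleftrightarrow> (\<forall>b\<in>B. norm b = 1) \<and> pairwise orthogonal B \<and> closure (span B) = UNIV"

definition onb :: "'h::real_inner set" where
  "onb = (SOME B. is_onb B)"

definition onb_lists :: "nat \<Rightarrow> 'h::real_inner list set" where
  "onb_lists n = {bs. length bs = n \<and> set bs \<subseteq> onb}"

definition hs_tensors :: "nat \<Rightarrow> 'h::real_inner tensor set" where
  "hs_tensors n = {F.
      (\<forall>xs. length xs \<noteq> n \<longrightarrow> F xs = 0) \<and>
      (\<forall>xs i. length xs = n \<longrightarrow> i < n \<longrightarrow> linear (\<lambda>x. F (xs[i := x]))) \<and>
      (\<exists>K. \<forall>xs. length xs = n \<longrightarrow> cmod (F xs) \<le> K * prod_list (map norm xs)) \<and>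
      (\<lambda>bs. (cmod (F bs))\<^sup>2) summable_on onb_lists n}"

definition tinner :: "nat \<Rightarrow> 'h::real_inner tensor \<Rightarrow> 'h tensor \<Rightarrow> complex" where
  "tinner n F G = (\<Sum>\<^sub>\<infinity>bs\<in>onb_lists n. cnj (F bs) * G bs)"

text \<open>\<open>U\<^sub>\<sigma>\<close>: pairing the factor with index \<open>inv \<sigma> i\<close> with the \<open>i\<close>-th argument, for all \<open>i\<close>,
  amounts to pairing the \<open>j\<close>-th factor with argument number \<open>\<sigma> j\<close>. List positions are counted
  from \<open>0\<close>, tensor factors from \<open>1\<close>.\<close>

definition tperm :: "(nat \<Rightarrow> nat) \<Rightarrow> 'h tensor \<Rightarrow> 'h tensor" where
  "tperm \<sigma> F = (\<lambda>xs. F (map (\<lambda>j. xs ! (\<sigma> (Suc j) - 1)) [0..<length xs]))"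

definition tprod :: "nat \<Rightarrow> 'h tensor \<Rightarrow> 'h tensor \<Rightarrow> 'h tensor" where
  "tprod n F G = (\<lambda>xs. F (take n xs) * G (drop n xs))"

definition contr_simple :: "(nat \<Rightarrow> nat) \<Rightarrow> 'h::real_inner list \<Rightarrow> 'h tensor" where
  "contr_simple \<pi> hs =
    tscale (complex_of_real (\<Prod>i | i < \<pi> i. inner (hs ! (i - 1)) (hs ! (\<pi> i - 1))))
           (simple_tensor (nths hs {j. Suc j \<notin> psupp \<pi>}))"

text \<open>The linear extension of \<^const>\<open>contr_simple\<close> to \<^term>\<open>calg_tensors n\<close>; see
  \<open>contr_sum\<close> below for well-definedness.\<close>

definition contr :: "nat \<Rightarrow> (nat \<Rightarrow> nat) \<Rightarrow> 'h::real_inner tensor \<Rightarrow> 'h tensor" where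
  "contr n \<pi> F = (THE G. \<exists>m c hs. (\<forall>k<m. length (hs k) = n) \<and>
      F = (\<Sum>k<m::nat. tscale (c k) (simple_tensor (hs k))) \<and>
      G = (\<Sum>k<m. tscale (c k) (contr_simple \<pi> (hs k))))"

lemma nths_prod:
  fixes f :: "'a \<Rightarrow> 'b \<Rightarrow> 'c::comm_monoid_mult"
  shows "(\<Prod>i<length (nths hs I). f (nths hs I ! i) (ys ! i)) =
   (\<Prod>i | i < length hs \<and> i \<in> I. f (hs ! i) (ys ! card {j\<in>I. j < i}))"
proof (induction hs rule: rev_induct)
  case Nil
  then show ?case by simp
next
  case (snoc a hs)
  let ?J = "{i. i < length hs \<and> i \<in> I}"
  have len: "length (nths hs I) = card ?J"
    by (simp add: length_nths)
  have eqJ: "{j\<in>I. j < length hs} = ?J" by auto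
  have IH': "(\<Prod>i<length (nths hs I). f ((nths hs I @ zs) ! i) (ys ! i)) =
     (\<Prod>i\<in>?J. f ((hs @ [a]) ! i) (ys ! card {j\<in>I. j < i}))" for zs
  proof -
    have "(\<Prod>i<length (nths hs I). f ((nths hs I @ zs) ! i) (ys ! i)) =
      (\<Prod>i<length (nths hs I). f (nths hs I ! i) (ys ! i))"
      by (intro prod.cong refl) (simp add: nth_append)
    moreover have "(\<Prod>i\<in>?J. f ((hs @ [a]) ! i) (ys ! card {j\<in>I. j < i})) =
      (\<Prod>i\<in>?J. f (hs ! i) (ys ! card {j\<in>I. j < i}))"
      by (intro prod.cong refl) (simp add: nth_append)
    ultimately show ?thesis using snoc.IH by simp
  qed
  show ?case
  proof (cases "length hs \<in> I")
    case True
    have ins: "{i. i < length (hs @ [a]) \<and> i \<in> I} = insert (length hs) ?J"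
      using True by auto
    show ?thesis
      unfolding ins nths_append
      using True IH'[of "[a]"] by (simp add: len eqJ nth_append mult.commute)
  next
    case False
    have ins: "{i. i < length (hs @ [a]) \<and> i \<in> I} = ?J"
      using False by (auto simp: less_Suc_eq)
    show ?thesis
      unfolding ins nths_append
      using False IH'[of "[]"] by simp
  qed
qed

lemma inner_parseval_finite:
  assumes "finite E" "pairwise orthogonal E" "\<forall>e\<in>E. norm e = 1" "x \<in> span E"
  shows "inner x y = (\<Sum>e\<in>E. inner x e * inner (y::'h::real_inner) e)"
proof -
  from assms(1,4) obtain u where u: "x = (\<Sum>e\<in>E. u e *\<^sub>R e)"
    by (auto simp: span_finite)
  have "inner x e = u e" if "e \<in> E" for e
  proof -
    have "inner x e = (\<Sum>d\<in>E. u d * inner d e)"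
      by (simp add: u inner_sum_left)
    also have "\<dots> = (\<Sum>d\<in>E. if d = e then u d else 0)"
      using assms(2,3) that
      by (intro sum.cong) (auto simp: pairwise_def orthogonal_def norm_eq_1)
    finally show ?thesis using that assms(1) by simp
  qed
  then have "(\<Sum>e\<in>E. inner x e * inner y e) = (\<Sum>e\<in>E. u e * inner e y)"
    by (intro sum.cong refl) (simp add: inner_commute)
  also have "\<dots> = inner x y"
    by (simp add: u inner_sum_left)
  finally show ?thesis by simp
qed

lemma ex_orthonormal:
  assumes "finite (H::'h::real_inner set)"
  shows "\<exists>E. finite E \<and> pairwise orthogonal E \<and> (\<forall>e\<in>E. norm e = 1) \<and> H \<subseteq> span E"
proof -
  obtain C where C: "finite C" "span C = span H" "pairwise orthogonal C"
    using basis_orthogonal[OF assms] by auto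
  let ?E = "(\<lambda>c. c /\<^sub>R norm c) ` (C - {0})"
  have "pairwise orthogonal ?E"
    using C(3) by (auto simp: pairwise_def orthogonal_def)
  moreover have "C \<subseteq> span ?E"
  proof
    fix c assume "c \<in> C"
    show "c \<in> span ?E"
    proof (cases "c = 0")
      case False
      then have "c /\<^sub>R norm c \<in> span ?E" using \<open>c \<in> C\<close> by (auto intro: span_base)
      then have "norm c *\<^sub>R (c /\<^sub>R norm c) \<in> span ?E" by (rule span_scale)
      then show ?thesis using False by simp
    qed (simp add: span_zero)
  qed
  then have "H \<subseteq> span ?E"
    using C(2) by (metis span_minimal subspace_span span_superset order_trans)
  ultimately show ?thesis using C(1) by (intro exI[of _ ?E]) auto
qed

lemma contr_simple_expand:
  fixes hs :: "'h::real_inner list"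
  assumes \<pi>: "\<pi> \<in> P12 n" and len: "length hs = n" and E: "finite E" "pairwise orthogonal E" "\<forall>e\<in>E. norm e = 1"
    and sub: "set hs \<subseteq> span E"
  defines "I \<equiv> {j. Suc j \<notin> psupp \<pi>}"
  shows "contr_simple \<pi> hs ys =
    (if length ys = card {j. j < n \<and> j \<in> I}
     then \<Sum>f\<in>Pi\<^sub>E {i. i < \<pi> i} (\<lambda>_. E). simple_tensor hs
       (map (\<lambda>j. if Suc j < \<pi> (Suc j) then f (Suc j) else if \<pi> (Suc j) < Suc j then f (\<pi> (Suc j))
                 else ys ! card {i\<in>I. i < j}) [0..<n])
     else 0)"
proof (cases "length ys = card {j. j < n \<and> j \<in> I}")
  case False
  then show ?thesis
    by (auto simp: contr_simple_def tscale_def simple_tensor_def length_nths len I_def)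
next
  case True
  let ?A = "{i. i < \<pi> i}" and ?B = "{i. \<pi> i < i}"
  have perm: "\<pi> permutes {1..n}" and inv: "\<And>i. \<pi> (\<pi> i) = i"
    using \<pi> by (auto simp: P12_def fun_eq_iff)
  have A: "?A \<subseteq> {1..n}" and B: "?B \<subseteq> {1..n}"
    using perm by (metis (mono_tags, lifting) mem_Collect_eq nat_neq_iff permutes_not_in subsetI)+
  have finA: "finite ?A" using A finite_subset by blast
  have bij: "bij_betw \<pi> ?A ?B"
    by (rule bij_betwI[where g=\<pi>]) (auto simp: inv)
  define X where "X f = (\<lambda>j. if Suc j < \<pi> (Suc j) then f (Suc j) else if \<pi> (Suc j) < Suc j then f (\<pi> (Suc j))
                 else ys ! card {i\<in>I. i < j})" for f :: "nat \<Rightarrow> 'h"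
  let ?h = "\<lambda>i. hs ! (i - 1)"
  define Y where "Y = (\<Prod>j | j < n \<and> j \<in> I. inner (hs ! j) (ys ! card {i\<in>I. i < j}))"
  have split: "(\<Prod>j<n. inner (hs ! j) (X f j)) =
      (\<Prod>i\<in>?A. inner (?h i) (f i) * inner (?h (\<pi> i)) (f i)) * Y" for f
  proof -
    have "(\<Prod>j<n. inner (hs ! j) (X f j)) = (\<Prod>i\<in>{1..n}. inner (?h i) (X f (i - 1)))"
      by (rule prod.reindex_bij_witness[of _ "\<lambda>i. i - 1" Suc]) auto
    also have "\<dots> = (\<Prod>i\<in>?A. inner (?h i) (X f (i - 1))) * (\<Prod>i\<in>?B. inner (?h i) (X f (i - 1)))
        * (\<Prod>i | i \<in> {1..n} \<and> \<pi> i = i. inner (?h i) (X f (i - 1)))"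
    proof -
      have un: "{1..n} = (?A \<union> ?B) \<union> {i. i \<in> {1..n} \<and> \<pi> i = i}"
      proof (intro equalityI subsetI)
        fix i assume "i \<in> {1..n}"
        then show "i \<in> (?A \<union> ?B) \<union> {i. i \<in> {1..n} \<and> \<pi> i = i}"
          using nat_neq_iff[of i "\<pi> i"] by simp metis
      next
        fix i assume "i \<in> (?A \<union> ?B) \<union> {i. i \<in> {1..n} \<and> \<pi> i = i}"
        then show "i \<in> {1..n}" using A B by blast
      qed
      have fin: "finite ?A" "finite ?B" "finite {i. i \<in> {1..n} \<and> \<pi> i = i}"
        using finA finite_subset[OF B] by simp_all
      have d: "?A \<inter> ?B = {}" "(?A \<union> ?B) \<inter> {i. i \<in> {1..n} \<and> \<pi> i = i} = {}"
        by auto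
      have "prod g {1..n} = prod g ?A * prod g ?B * prod g {i. i \<in> {1..n} \<and> \<pi> i = i}" for g :: "nat \<Rightarrow> real"
        using prod.union_disjoint[OF finite_UnI[OF fin(1,2)] fin(3) d(2), of g]
          prod.union_disjoint[OF fin(1,2) d(1), of g] unfolding un[symmetric] by simp
      then show ?thesis .
    qed
    also have "(\<Prod>i\<in>?A. inner (?h i) (X f (i - 1))) = (\<Prod>i\<in>?A. inner (?h i) (f i))"
    proof (rule prod.cong[OF refl])
      fix i assume "i \<in> ?A"
      moreover then have "Suc (i - 1) = i" using A by force
      ultimately show "inner (?h i) (X f (i - 1)) = inner (?h i) (f i)"
        unfolding X_def by simp
    qed
    also have "(\<Prod>i\<in>?B. inner (?h i) (X f (i - 1))) = (\<Prod>i\<in>?B. inner (?h i) (f (\<pi> i)))"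
    proof (rule prod.cong[OF refl])
      fix i assume "i \<in> ?B"
      moreover then have "Suc (i - 1) = i" using B by force
      ultimately show "inner (?h i) (X f (i - 1)) = inner (?h i) (f (\<pi> i))"
        unfolding X_def by simp
    qed
    also have "\<dots> = (\<Prod>i\<in>?A. inner (?h (\<pi> i)) (f i))"
      using prod.reindex_bij_betw[OF bij, of "\<lambda>i. inner (?h i) (f (\<pi> i))"] by (simp add: inv)
    also have "(\<Prod>i | i \<in> {1..n} \<and> \<pi> i = i. inner (?h i) (X f (i - 1))) = Y"
      unfolding Y_def
      by (rule prod.reindex_bij_witness[of _ Suc "\<lambda>i. i - 1"]) (auto simp: X_def I_def psupp_def)
    finally show ?thesis by (simp add: prod.distrib)
  qed
  have "contr_simple \<pi> hs ys = complex_of_real ((\<Prod>i\<in>?A. inner (?h i) (?h (\<pi> i))) * Y)"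
  proof -
    have "length ys = length (nths hs I)" using True by (simp add: length_nths len)
    moreover have "(\<Prod>i<length (nths hs I). inner (nths hs I ! i) (ys ! i)) = Y"
      unfolding nths_prod Y_def len ..
    ultimately show ?thesis
      unfolding contr_simple_def tscale_def simple_tensor_def I_def[symmetric] by simp
  qed
  also have "(\<Prod>i\<in>?A. inner (?h i) (?h (\<pi> i))) =
      (\<Prod>i\<in>?A. \<Sum>e\<in>E. inner (?h i) e * inner (?h (\<pi> i)) e)"
  proof (rule prod.cong[OF refl])
    fix i assume "i \<in> ?A"
    then have "?h i \<in> set hs" using A len by (intro nth_mem) force
    then show "inner (?h i) (?h (\<pi> i)) = (\<Sum>e\<in>E. inner (?h i) e * inner (?h (\<pi> i)) e)"
      using sub by (intro inner_parseval_finite E) auto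
  qed
  also have "\<dots> = (\<Sum>f\<in>Pi\<^sub>E ?A (\<lambda>_. E). \<Prod>i\<in>?A. inner (?h i) (f i) * inner (?h (\<pi> i)) (f i))"
    by (rule prod_sum_PiE[OF finA E(1)])
  also have "complex_of_real (\<dots> * Y) = (\<Sum>f\<in>Pi\<^sub>E ?A (\<lambda>_. E). complex_of_real (\<Prod>j<n. inner (hs ! j) (X f j)))"
    unfolding split by (simp add: sum_distrib_right del: of_real_mult of_real_prod)
  also have "\<dots> = (\<Sum>f\<in>Pi\<^sub>E ?A (\<lambda>_. E). simple_tensor hs (map (X f) [0..<n]))"
    by (intro sum.cong refl) (simp add: simple_tensor_def len del: of_real_prod)
  finally show ?thesis using True by (simp add: X_def)
qed

lemma sum_fun_apply: "(\<Sum>k\<in>A. f k) x = (\<Sum>k\<in>A. f k x)" for f :: "'a \<Rightarrow> 'b \<Rightarrow> 'c::comm_monoid_add"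
  by (induction A rule: infinite_finite_induct) auto

lemma contr_simple_wd:
  fixes hs :: "nat \<Rightarrow> 'h::real_inner list"
  assumes \<pi>: "\<pi> \<in> P12 n" and len: "\<forall>k<m. length (hs k) = n"  "\<forall>k<m'. length (hs' k) = n"
    and eq: "(\<Sum>k<m::nat. tscale (c k) (simple_tensor (hs k))) = (\<Sum>k<m'::nat. tscale (c' k) (simple_tensor (hs' k)))"
  shows "(\<Sum>k<m. tscale (c k) (contr_simple \<pi> (hs k))) = (\<Sum>k<m'. tscale (c' k) (contr_simple \<pi> (hs' k)))"
proof -
  obtain E where E: "finite E" "pairwise orthogonal E" "\<forall>e\<in>E. norm e = 1"
     "(\<Union>k<m. set (hs k)) \<union> (\<Union>k<m'. set (hs' k)) \<subseteq> span E"
    using ex_orthonormal[of "(\<Union>k<m. set (hs k)) \<union> (\<Union>k<m'. set (hs' k))"] by auto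
  define I where "I = {j. Suc j \<notin> psupp \<pi>}"
  have key: "(\<Sum>k<m. tscale (c k) (contr_simple \<pi> (hs k))) ys =
    (if length ys = card {j. j < n \<and> j \<in> I}
     then \<Sum>f\<in>Pi\<^sub>E {i. i < \<pi> i} (\<lambda>_. E). (\<Sum>k<m. tscale (c k) (simple_tensor (hs k)))
       (map (\<lambda>j. if Suc j < \<pi> (Suc j) then f (Suc j) else if \<pi> (Suc j) < Suc j then f (\<pi> (Suc j))
                 else ys ! card {i\<in>I. i < j}) [0..<n])
     else 0)" if "\<forall>k<m. length (hs k) = n" "(\<Union>k<m. set (hs k)) \<subseteq> span E"
     for m c ys and hs :: "nat \<Rightarrow> 'h list"
  proof -
    have "contr_simple \<pi> (hs k) ys =
    (if length ys = card {j. j < n \<and> j \<in> I}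
     then \<Sum>f\<in>Pi\<^sub>E {i. i < \<pi> i} (\<lambda>_. E). simple_tensor (hs k)
       (map (\<lambda>j. if Suc j < \<pi> (Suc j) then f (Suc j) else if \<pi> (Suc j) < Suc j then f (\<pi> (Suc j))
                 else ys ! card {i\<in>I. i < j}) [0..<n])
     else 0)" if "k < m" for k
      unfolding I_def
      by (rule contr_simple_expand[OF \<pi> _ E(1-3)]) (use that \<open>\<forall>k<m. length (hs k) = n\<close> \<open>(\<Union>k<m. set (hs k)) \<subseteq> span E\<close> in auto)
    then show ?thesis
      by (cases "length ys = card {j. j < n \<and> j \<in> I}")
        (simp_all add: sum_fun_apply tscale_def sum_distrib_left sum.swap[of _ "{..<m}"])
  qed
  show ?thesis
  proof
    fix ys
    have E': "(\<Union>k<m. set (hs k)) \<subseteq> span E" "(\<Union>k<m'. set (hs' k)) \<subseteq> span E"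
      using E(4) by blast+
    show "(\<Sum>k<m. tscale (c k) (contr_simple \<pi> (hs k))) ys =
        (\<Sum>k<m'. tscale (c' k) (contr_simple \<pi> (hs' k))) ys"
      unfolding key[OF len(1) E'(1)] key[OF len(2) E'(2)] eq ..
  qed
qed

lemma contr_sum:
  assumes "\<pi> \<in> P12 n" "\<forall>k<m. length (hs k) = n"
  shows "contr n \<pi> (\<Sum>k<m::nat. tscale (c k) (simple_tensor (hs k))) =
    (\<Sum>k<m. tscale (c k) (contr_simple \<pi> (hs k)))"
proof -
  let ?P = "\<lambda>G. \<exists>m' c' hs'. (\<forall>k<m'. length (hs' k) = n) \<and>
      (\<Sum>k<m. tscale (c k) (simple_tensor (hs k))) = (\<Sum>k<m'::nat. tscale (c' k) (simple_tensor (hs' k))) \<and>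
      G = (\<Sum>k<m'. tscale (c' k) (contr_simple \<pi> (hs' k)))"
  have "?P (\<Sum>k<m. tscale (c k) (contr_simple \<pi> (hs k)))"
    using assms(2) by (intro exI[of _ m] exI[of _ c] exI[of _ hs]) simp
  moreover have "G = (\<Sum>k<m. tscale (c k) (contr_simple \<pi> (hs k)))" if PG: "?P G" for G
  proof -
    obtain m' c' hs' where h: "\<forall>k<m'. length (hs' k) = n"
      "(\<Sum>k<m. tscale (c k) (simple_tensor (hs k))) = (\<Sum>k<m'::nat. tscale (c' k) (simple_tensor (hs' k)))"
      "G = (\<Sum>k<m'. tscale (c' k) (contr_simple \<pi> (hs' k)))"
      using PG by (elim exE conjE)
    show ?thesis unfolding h(3) using contr_simple_wd[OF assms h(1,2)] by (rule sym)
  qed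
  ultimately show ?thesis unfolding contr_def by (rule the_equality)
qed

section \<open>The space spanned by permutations and tensors\<close>

text \<open>An element \<open>\<Xi>\<close> of \<open>\<Oplus>\<^sub>n \<complex>[S\<^sub>0(n)] \<otimes> V\<^sub>n\<close> is represented by the family of its coefficients
  \<open>\<Xi> n \<alpha> \<in> V\<^sub>n\<close>, and \<open>\<alpha> \<otimes>\<^sub>s F\<close> is \<open>sym_pure n \<alpha> F\<close>. Maps that are prescribed on the elements
  \<open>\<alpha> \<otimes> F\<close> are written as their (multi)linear extensions to the whole direct sum. The prescribed
  values are unchanged when \<open>\<alpha> \<otimes> F\<close> is replaced by \<open>\<sigma>\<alpha>\<sigma>\<^sup>-\<^sup>1 \<otimes> U\<^sub>\<sigma>F\<close>, or, for \<open>Rmap\<close> and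
  \<open>inv_conj\<close>, change in the same way; hence on the span of the \<open>\<alpha> \<otimes>\<^sub>s F\<close> the extensions satisfy
  the prescribed formulas with \<open>\<otimes>\<^sub>s\<close>. The notation \<open>W(\<xi>)\<close> is the identity map.\<close>

type_synonym 'h ptensor = "nat \<Rightarrow> (nat \<Rightarrow> nat) \<Rightarrow> 'h tensor"

definition pscale :: "complex \<Rightarrow> 'h ptensor \<Rightarrow> 'h ptensor" where
  "pscale c \<Xi> = (\<lambda>n \<alpha>. tscale c (\<Xi> n \<alpha>))"

lemma vector_space_pscale: "vector_space (pscale :: complex \<Rightarrow> 'h ptensor \<Rightarrow> 'h ptensor)"
proof
  fix a b :: complex and x y :: "'h ptensor"
  show "pscale a (x + y) = pscale a x + pscale a y"
    unfolding pscale_def tscale_def by (intro ext) (simp add: distrib_left)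
  show "pscale (a + b) x = pscale a x + pscale b x"
    unfolding pscale_def tscale_def by (intro ext) (simp add: distrib_right)
  show "pscale a (pscale b x) = pscale (a * b) x"
    unfolding pscale_def tscale_def by (intro ext) simp
  show "pscale 1 x = x"
    unfolding pscale_def tscale_def by simp
qed

global_interpretation pt: vector_space pscale
  by (rule vector_space_pscale)

definition pure :: "nat \<Rightarrow> (nat \<Rightarrow> nat) \<Rightarrow> 'h tensor \<Rightarrow> 'h ptensor" where
  "pure n \<alpha> F = (\<lambda>m \<beta>. if m = n \<and> \<beta> = \<alpha> then F else 0)"

definition sym_pure :: "nat \<Rightarrow> (nat \<Rightarrow> nat) \<Rightarrow> 'h tensor \<Rightarrow> 'h ptensor" where
  "sym_pure n \<alpha> F =
    pscale (1 / fact n) (\<Sum>\<sigma>\<in>Sym1 n. pure n (\<sigma> \<circ> \<alpha> \<circ> inv \<sigma>) (tperm \<sigma> F))"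

definition TP :: "'h::real_inner ptensor set" where
  "TP = pt.span {sym_pure n \<alpha> F |n \<alpha> F. \<alpha> \<in> Sym0 n \<and> F \<in> ralg_tensors n}"

definition Rmap :: "'h ptensor \<Rightarrow> 'h ptensor" where
  "Rmap \<Xi> = (\<lambda>n \<alpha>. tscale ((-1) ^ plen n \<alpha>) (\<Xi> n \<alpha>))"

text \<open>In the sums over degrees, \<open>{n. \<Xi> n \<noteq> 0}\<close> is finite for every element of the direct sum.\<close>

definition Tmap :: "real \<Rightarrow> 'h::real_inner ptensor \<Rightarrow> 'h ptensor" where
  "Tmap q \<Xi> = (\<Sum>n | \<Xi> n \<noteq> 0. \<Sum>\<alpha>\<in>Sym0 n. \<Sum>\<pi>\<in>P12 n.
      pscale (complex_of_real (contr_coeff q n \<pi> \<alpha>))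
        (sym_pure (n - 2 * npairs \<pi>) (contr_perm \<pi> \<alpha>) (contr n \<pi> (\<Xi> n \<alpha>))))"

text \<open>The bilinear extension of \<open>(\<alpha> \<otimes> F, \<beta> \<otimes> G) \<mapsto> (\<alpha> \<union> \<beta>) \<otimes>\<^sub>s (F \<otimes> G)\<close> and the antilinear
  extension of \<open>\<alpha> \<otimes> F \<mapsto> \<alpha>\<^sup>-\<^sup>1 \<otimes> F\<close> for real tensors \<open>F\<close>, which are real-valued forms.\<close>

definition cup_prod :: "'h ptensor \<Rightarrow> 'h ptensor \<Rightarrow> 'h ptensor" where
  "cup_prod \<Xi> \<Theta> = (\<Sum>n | \<Xi> n \<noteq> 0. \<Sum>k | \<Theta> k \<noteq> 0. \<Sum>\<alpha>\<in>Sym0 n. \<Sum>\<beta>\<in>Sym0 k.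
      sym_pure (n + k) (perm_cup n \<alpha> \<beta>) (tprod n (\<Xi> n \<alpha>) (\<Theta> k \<beta>)))"

definition inv_conj :: "'h ptensor \<Rightarrow> 'h ptensor" where
  "inv_conj \<Xi> = (\<lambda>n \<alpha>. if \<alpha> \<in> Sym0 n then (\<lambda>xs. cnj (\<Xi> n (inv \<alpha>) xs)) else 0)"

text \<open>\<open>Tmap q\<close> is a bijection of \<^const>\<open>TP\<close>, because \<open>Tmap q \<Xi> - \<Xi>\<close> has only terms of lower degree;
  the product and the adjoint are transported along it.\<close>

definition qmult :: "real \<Rightarrow> 'h::real_inner ptensor \<Rightarrow> 'h ptensor \<Rightarrow> 'h ptensor" where
  "qmult q X Y = Tmap q (cup_prod (inv_into TP (Tmap q) X) (inv_into TP (Tmap q) Y))"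

definition qadj :: "real \<Rightarrow> 'h::real_inner ptensor \<Rightarrow> 'h ptensor" where
  "qadj q X = Tmap q (inv_conj (inv_into TP (Tmap q) X))"

text \<open>The functional reads off the coefficient of the identity of \<open>S\<^sub>0(0)\<close>. As a functional on the
  vector space \<^const>\<open>TP\<close> it is the same for all \<open>q\<close>.\<close>

definition phi :: "real \<Rightarrow> 'h ptensor \<Rightarrow> complex" where
  "phi q X = X 0 id []"

definition star_isomorphism ::
  "'h ptensor set \<Rightarrow> ('h ptensor \<Rightarrow> 'h ptensor \<Rightarrow> 'h ptensor) \<Rightarrow> ('h ptensor \<Rightarrow> 'h ptensor) \<Rightarrow>
   'h ptensor set \<Rightarrow> ('h ptensor \<Rightarrow> 'h ptensor \<Rightarrow> 'h ptensor) \<Rightarrow> ('h ptensor \<Rightarrow> 'h ptensor) \<Rightarrow>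
   ('h ptensor \<Rightarrow> 'h ptensor) \<Rightarrow> bool" where
  "star_isomorphism A m s A' m' s' f \<longleftrightarrow>
    bij_betw f A A' \<and>
    (\<forall>X\<in>A. \<forall>Y\<in>A. f (X + Y) = f X + f Y) \<and>
    (\<forall>c. \<forall>X\<in>A. f (pscale c X) = pscale c (f X)) \<and>
    (\<forall>X\<in>A. \<forall>Y\<in>A. f (m X Y) = m' (f X) (f Y)) \<and>
    (\<forall>X\<in>A. f (s X) = s' (f X))"

section \<open>Fock space\<close>

definition pre_fock :: "'h::real_inner ptensor set" where
  "pre_fock = pt.span {sym_pure n \<alpha> F |n \<alpha> F. \<alpha> \<in> Sym0 n \<and> F \<in> hs_tensors n}"

definition fock_form :: "real \<Rightarrow> 'h::real_inner ptensor \<Rightarrow> 'h ptensor \<Rightarrow> complex" where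
  "fock_form q \<Xi> \<Theta> = (\<Sum>n | \<Xi> n \<noteq> 0. \<Sum>\<alpha>\<in>Sym0 n. \<Sum>\<beta>\<in>Sym0 n. \<Sum>\<sigma>\<in>Sym1 n.
      complex_of_real (chi q n (\<alpha> \<circ> \<sigma> \<circ> inv \<beta> \<circ> inv \<sigma>)) * tinner n (\<Xi> n \<alpha>) (tperm \<sigma> (\<Theta> n \<beta>)))"

text \<open>Hilbert space completion of the quotient of a space \<open>V\<close> with a positive semi-definite
  sesquilinear form \<open>s\<close> by its kernel: classes of Cauchy sequences for the seminorm of \<open>s\<close> modulo
  sequences of seminorm tending to \<open>0\<close>. Constant sequences are equivalent iff they differ by an
  element of the kernel.\<close>

definition form_norm :: "('h ptensor \<Rightarrow> 'h ptensor \<Rightarrow> complex) \<Rightarrow> 'h ptensor \<Rightarrow> real" where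
  "form_norm s v = sqrt (Re (s v v))"

definition cauchy_seqs ::
  "'h ptensor set \<Rightarrow> ('h ptensor \<Rightarrow> 'h ptensor \<Rightarrow> complex) \<Rightarrow> (nat \<Rightarrow> 'h ptensor) set" where
  "cauchy_seqs V s = {X. range X \<subseteq> V \<and>
      (\<forall>e>0. \<exists>M. \<forall>j\<ge>M. \<forall>k\<ge>M. form_norm s (X j - X k) < e)}"

definition null_rel ::
  "'h ptensor set \<Rightarrow> ('h ptensor \<Rightarrow> 'h ptensor \<Rightarrow> complex) \<Rightarrow> (nat \<Rightarrow> 'h ptensor) rel" where
  "null_rel V s = {(X, Y). X \<in> cauchy_seqs V s \<and> Y \<in> cauchy_seqs V s \<and>
      (\<lambda>k. form_norm s (X k - Y k)) \<longlonglongrightarrow> 0}"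

definition hcompl ::
  "'h ptensor set \<Rightarrow> ('h ptensor \<Rightarrow> 'h ptensor \<Rightarrow> complex) \<Rightarrow> (nat \<Rightarrow> 'h ptensor) set set" where
  "hcompl V s = cauchy_seqs V s // null_rel V s"

definition hembed ::
  "'h ptensor set \<Rightarrow> ('h ptensor \<Rightarrow> 'h ptensor \<Rightarrow> complex) \<Rightarrow> 'h ptensor \<Rightarrow> (nat \<Rightarrow> 'h ptensor) set" where
  "hembed V s v = null_rel V s `` {\<lambda>_. v}"

definition hadd ::
  "'h ptensor set \<Rightarrow> ('h ptensor \<Rightarrow> 'h ptensor \<Rightarrow> complex) \<Rightarrow>
   (nat \<Rightarrow> 'h ptensor) set \<Rightarrow> (nat \<Rightarrow> 'h ptensor) set \<Rightarrow> (nat \<Rightarrow> 'h ptensor) set" where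
  "hadd V s C D = (\<Union>X\<in>C. \<Union>Y\<in>D. null_rel V s `` {\<lambda>k. X k + Y k})"

definition hscale ::
  "'h ptensor set \<Rightarrow> ('h ptensor \<Rightarrow> 'h ptensor \<Rightarrow> complex) \<Rightarrow>
   complex \<Rightarrow> (nat \<Rightarrow> 'h ptensor) set \<Rightarrow> (nat \<Rightarrow> 'h ptensor) set" where
  "hscale V s c C = (\<Union>X\<in>C. null_rel V s `` {\<lambda>k. pscale c (X k)})"

definition hinner ::
  "('h ptensor \<Rightarrow> 'h ptensor \<Rightarrow> complex) \<Rightarrow>
   (nat \<Rightarrow> 'h ptensor) set \<Rightarrow> (nat \<Rightarrow> 'h ptensor) set \<Rightarrow> complex" where
  "hinner s C D = (THE z. \<forall>X\<in>C. \<forall>Y\<in>D. (\<lambda>k. s (X k) (Y k)) \<longlonglongrightarrow> z)"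

definition isometry_onto ::
  "'h ptensor set \<Rightarrow> ('h ptensor \<Rightarrow> 'h ptensor \<Rightarrow> complex) \<Rightarrow>
   'h ptensor set \<Rightarrow> ('h ptensor \<Rightarrow> 'h ptensor \<Rightarrow> complex) \<Rightarrow>
   ((nat \<Rightarrow> 'h ptensor) set \<Rightarrow> (nat \<Rightarrow> 'h ptensor) set) \<Rightarrow> bool" where
  "isometry_onto V s V' s' \<Phi> \<longleftrightarrow>
    \<Phi> ` hcompl V s = hcompl V' s' \<and>
    (\<forall>C\<in>hcompl V s. \<forall>D\<in>hcompl V s. \<Phi> (hadd V s C D) = hadd V' s' (\<Phi> C) (\<Phi> D)) \<and>
    (\<forall>c. \<forall>C\<in>hcompl V s. \<Phi> (hscale V s c C) = hscale V' s' c (\<Phi> C)) \<and>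
    (\<forall>C\<in>hcompl V s. \<forall>D\<in>hcompl V s. hinner s' (\<Phi> C) (\<Phi> D) = hinner s C D)"

definition induces_isometry_onto ::
  "'h ptensor set \<Rightarrow> ('h ptensor \<Rightarrow> 'h ptensor \<Rightarrow> complex) \<Rightarrow>
   'h ptensor set \<Rightarrow> ('h ptensor \<Rightarrow> 'h ptensor \<Rightarrow> complex) \<Rightarrow> ('h ptensor \<Rightarrow> 'h ptensor) \<Rightarrow> bool" where
  "induces_isometry_onto V s V' s' f \<longleftrightarrow>
    f ` V \<subseteq> V' \<and>
    (\<exists>\<Phi>. isometry_onto V s V' s' \<Phi> \<and> (\<forall>v\<in>V. \<Phi> (hembed V s v) = hembed V' s' (f v)))"

end

theory Submission
  imports Defs
begin

text \<open>Let \<open>\<epsilon>(\<alpha>)\<close> be the sign of \<open>\<alpha> \<in> S\<^sub>0(n)\<close>. Since \<open>|\<alpha>|\<close> is the number of points minus the number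
  of cycles on \<open>[0, n]\<close>, we have \<open>(-1)\<^bsup>|\<alpha>|\<^esup> = \<epsilon>(\<alpha>)\<close> (\<open>sign_eq_plen\<close>). So \<open>R\<close> is multiplication
  by a group homomorphism, and every part of the theorem reduces to the multiplicativity of \<open>\<epsilon>\<close>.

  For part (i), the exponent of \<open>q\<close> in \<open>C\<^sub>\<pi>\<^sup>(\<^sup>q\<^sup>)(\<alpha>)\<close> is a difference of cycle numbers plus the
  number of pairs. Read as signs, it says that the coefficients for \<open>q\<close> and for \<open>-q\<close> differ by the
  product of the signs of \<open>\<alpha>\<close> and of its contraction (\<open>contr_coeff_minus\<close>); hence
  \<open>R T\<^sup>(\<^sup>q\<^sup>) = T\<^sup>(\<^sup>-\<^sup>q\<^sup>) R\<close> (\<open>Rmap_Tmap\<close>).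

  For part (ii), \<open>\<epsilon>(\<alpha> \<union> \<beta>) = \<epsilon>(\<alpha>) \<epsilon>(\<beta>)\<close> and \<open>\<epsilon>(\<alpha>\<^sup>-\<^sup>1) = \<epsilon>(\<alpha>)\<close> show that \<open>R\<close> respects the product
  and the involution before they are transported along \<open>T\<^sup>(\<^sup>q\<^sup>)\<close>. The transport goes through because
  \<open>T\<^sup>(\<^sup>q\<^sup>)\<close> is a bijection of \<^const>\<open>TP\<close>: it is the identity up to terms of lower degree
  (\<open>inj_on_Tmap\<close>, \<open>Tmap_surj\<close>).

  Part (iii) holds because \<open>R\<close> is the identity in degree \<open>0\<close>. For part (iv),
  \<open>\<chi>\<^sub>-\<^sub>q = \<epsilon> \<chi>\<^sub>q\<close> shows that \<open>R\<close> carries one sesquilinear form to the other (\<open>fock_form_Rmap\<close>), and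
  a form-preserving linear bijection extends to the completions (\<open>induces_isometry_ontoI\<close>).\<close>

section \<open>Cycle numbers and signs\<close>

text \<open>Following \<open>p\<close> by the transposition of \<open>a\<close> and \<open>p a\<close> short-circuits \<open>a\<close>: the point becomes
  fixed, and the cycle it was on loses nothing else. This makes it possible to count cycles by
  removing one point at a time.\<close>

lemma orbit_transpose_comp:
  assumes p: "p permutes insert a A" "a \<notin> A" and x: "x \<in> A"
  defines "p' \<equiv> Transposition.transpose a (p a) \<circ> p"
  shows "orbit p' x = orbit p x - {a}"
proof -
  have p'y: "p' y = (if p y = a then p a else p y)" if "y \<noteq> a" for y
    using that injD[OF permutes_inj[OF p(1)], of y a]
    by (auto simp: p'_def Transposition.transpose_def)
  have p': "p' permutes A"
    unfolding p'_def by (rule permutes_insert_lemma[OF p(1)])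
  show ?thesis
  proof (intro equalityI subsetI)
    fix y assume y: "y \<in> orbit p' x"
    then have "y \<in> orbit p x"
    proof induction
      case base
      show ?case
        using x p(2) orbit.base[of p x] orbit.step[OF orbit.base, of p x]
        by (subst p'y) auto
    next
      case (step y)
      then have "y \<in> A" using permutes_orbit_subset[OF p' x] by auto
      then have "y \<noteq> a" using p(2) by auto
      then show ?case
        using step.IH orbit.step[OF orbit.step[OF step.IH]]
        by (auto simp: p'y intro: orbit.step)
    qed
    moreover have "y \<in> A" using y permutes_orbit_subset[OF p' x] by auto
    ultimately show "y \<in> orbit p x - {a}" using p(2) by auto
  next
    fix y assume y: "y \<in> orbit p x - {a}"
    then have "y \<in> orbit p x" by simp
    \<comment> \<open>An orbit that runs through \<open>a\<close> continues in \<open>p a\<close>, which is the point that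
      \<open>p'\<close> reaches instead of \<open>a\<close>.\<close>
    then have "if y = a then p a = a \<or> p a \<in> orbit p' x else y \<in> orbit p' x"
    proof induction
      case base
      have "x \<noteq> a" using x p(2) by auto
      then show ?case using orbit.base[of p' x] by (simp add: p'y split: if_splits)
    next
      case (step y)
      show ?case
      proof (cases "y = a")
        case True
        then show ?thesis using step.IH by auto
      next
        case False
        then have "p' y \<in> orbit p' x" using step.IH by (auto intro: orbit.step)
        then show ?thesis using False by (simp add: p'y split: if_splits)
      qed
    qed
    then show "y \<in> orbit p' x" using y by simp
  qed
qed

text \<open>Removing a fixed point loses one element and one cycle and keeps the sign. Removing any other
  point loses one element, keeps the number of cycles and costs one transposition. Both effects
  agree with the formula. The removed point is never \<open>0\<close>, so the uncounted cycle of \<open>0\<close> survives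
  to the end of the induction, where it is the only one.\<close>

lemma sign_eq_cyc0_insert:
  assumes "finite S" "0 \<notin> S" "p permutes insert 0 S"
  shows "sign p = (-1) ^ (card S + cyc0 (insert 0 S) p) \<and> cyc0 (insert 0 S) p \<le> card S"
  using assms
proof (induction S arbitrary: p)
  case empty
  then have p: "p = id" by simp
  have "orbit id (0::nat) = {0}" by (simp add: orbit_eq_singleton_iff)
  then have "cyc0 {0} id = card ({} :: nat set set)"
    unfolding cyc0_def by (intro arg_cong[where f = card]) auto
  then show ?case using p by (simp add: id_def)
next
  case (insert a S)
  let ?A = "insert 0 S"
  let ?orbs = "\<lambda>A p. {orbit p x |x. x \<in> A \<and> 0 \<notin> orbit p x}"
  have a: "a \<notin> ?A" "a \<noteq> 0" using insert.hyps insert.prems(1) by auto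
  have p: "p permutes insert a ?A"
    using insert.prems(2) by (simp add: insert_commute)
  have ins: "insert 0 (insert a S) = insert a ?A" by auto
  define p' where "p' = Transposition.transpose a (p a) \<circ> p"
  have p': "p' permutes ?A"
    unfolding p'_def by (rule permutes_insert_lemma[OF p])
  have IH: "sign p' = (-1) ^ (card S + cyc0 ?A p')" "cyc0 ?A p' \<le> card S"
    using insert.IH[OF _ p'] insert.prems(1) by auto
  have orb: "orbit p' x = orbit p x - {a}" if "x \<in> ?A" for x
    unfolding p'_def by (rule orbit_transpose_comp[OF p a(1) that])
  have finA: "finite ?A" using insert.hyps by simp
  show ?case
  proof (cases "p a = a")
    case True
    then have [simp]: "p' = p" by (simp add: p'_def)
    have oa: "orbit p a = {a}" using True by (simp add: orbit_eq_singleton_iff)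
    have "?orbs (insert a ?A) p = insert {a} (?orbs ?A p)" using oa a(2) by auto
    moreover have "{a} \<notin> ?orbs ?A p"
    proof
      assume "{a} \<in> ?orbs ?A p"
      then obtain x where "x \<in> ?A" "{a} = orbit p x" by blast
      then show False using permutes_orbit_subset[of p ?A x] p' a(1) by auto
    qed
    moreover have "finite (?orbs ?A p)" using finA by simp
    ultimately have "cyc0 (insert a ?A) p = Suc (cyc0 ?A p)"
      by (simp add: cyc0_def)
    then show ?thesis unfolding ins using IH insert.hyps by simp
  next
    case False
    have perm: "permutation p"
      using p finA by (auto intro: permutes_imp_permutation[of "insert a ?A"])
    have pa: "p a \<in> ?A" using p False by (metis insertE insertI1 permutes_in_image)
    have self: "x \<in> orbit p x" for x
      by (rule permutation_self_in_orbit[OF perm])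
    have oeq: "orbit p x = orbit p y" if "z \<in> orbit p x" "z \<in> orbit p y" for x y z
      using that self
      by (metis orbit_cyclic_eq3 cyclic_on_orbit'[OF perm])
    have oa: "orbit p a = orbit p (p a)"
      by (rule oeq[OF orbit.base self])
    have "?orbs ?A p' = (\<lambda>X. X - {a}) ` ?orbs (insert a ?A) p"
    proof (intro equalityI subsetI)
      fix X assume "X \<in> ?orbs ?A p'"
      then obtain x where x: "x \<in> ?A" "X = orbit p' x" "0 \<notin> orbit p' x" by blast
      then have "X = orbit p x - {a}" "0 \<notin> orbit p x" using orb[OF x(1)] a(2) by auto
      then show "X \<in> (\<lambda>X. X - {a}) ` ?orbs (insert a ?A) p" using x(1) by blast
    next
      fix X assume "X \<in> (\<lambda>X. X - {a}) ` ?orbs (insert a ?A) p"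
      then obtain x where x: "x \<in> insert a ?A" "X = orbit p x - {a}" "0 \<notin> orbit p x" by blast
      then obtain y where y: "y \<in> ?A" "X = orbit p y - {a}" "0 \<notin> orbit p y"
        using oa pa by (cases "x = a") auto
      then show "X \<in> ?orbs ?A p'" using orb[OF y(1)] by auto
    qed
    moreover have "inj_on (\<lambda>X. X - {a}) (?orbs (insert a ?A) p)"
    proof (rule inj_onI)
      fix X Y assume XY: "X \<in> ?orbs (insert a ?A) p" "Y \<in> ?orbs (insert a ?A) p" "X - {a} = Y - {a}"
      obtain x where x: "x \<in> ?A" "X = orbit p x"
        using XY(1) oa pa by auto
      obtain y where y: "y \<in> ?A" "Y = orbit p y"
        using XY(2) oa pa by auto
      have "x \<in> orbit p x - {a}" using self[of x] x(1) a(1) by auto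
      then have "x \<in> orbit p y" using XY(3) unfolding x(2) y(2) by auto
      then show "X = Y" unfolding x(2) y(2) using oeq[OF self] by auto
    qed
    ultimately have cyc: "cyc0 (insert a ?A) p = cyc0 ?A p'"
      by (simp add: cyc0_def card_image)
    have "sign p' = - sign p"
      unfolding p'_def using perm False by (simp add: sign_compose permutation_swap_id sign_swap_id)
    then show ?thesis unfolding ins cyc using IH insert.hyps by simp
  qed
qed

lemma sign_eq_cyc0:
  assumes "finite A" "0 \<in> A" "p permutes A"
  shows "sign p = (-1) ^ (card A - 1 + cyc0 A p)" "cyc0 A p \<le> card A - 1"
  using sign_eq_cyc0_insert[of "A - {0}" p] assms by (simp_all add: insert_absorb)

section \<open>Signs of contractions, shifts and unions\<close>

lemma Sym0_perm: "\<alpha> \<in> Sym0 n \<Longrightarrow> permutation \<alpha>"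
  by (auto simp: Sym0_def permutation_permutes)

lemma Sym1_subset_Sym0: "\<sigma> \<in> Sym1 n \<Longrightarrow> \<sigma> \<in> Sym0 n"
  by (auto simp: Sym0_def Sym1_def elim: permutes_subset)

lemma Sym0_comp: "\<alpha> \<in> Sym0 n \<Longrightarrow> \<beta> \<in> Sym0 n \<Longrightarrow> \<alpha> \<circ> \<beta> \<in> Sym0 n"
  by (simp add: Sym0_def permutes_compose)

lemma Sym0_inv: "\<alpha> \<in> Sym0 n \<Longrightarrow> inv \<alpha> \<in> Sym0 n"
  by (simp add: Sym0_def permutes_inv)

lemma Sym0_conj: "\<alpha> \<in> Sym0 n \<Longrightarrow> \<sigma> \<in> Sym1 n \<Longrightarrow> \<sigma> \<circ> \<alpha> \<circ> inv \<sigma> \<in> Sym0 n"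
  using Sym1_subset_Sym0[of \<sigma> n] by (intro Sym0_comp Sym0_inv)

lemma sign_comp: "\<alpha> \<in> Sym0 n \<Longrightarrow> \<beta> \<in> Sym0 n \<Longrightarrow> sign (\<alpha> \<circ> \<beta>) = sign \<alpha> * sign \<beta>"
  by (intro sign_compose Sym0_perm)

lemma sign_inv: "\<alpha> \<in> Sym0 n \<Longrightarrow> sign (inv \<alpha>) = sign \<alpha>"
  by (intro sign_inverse Sym0_perm)

lemma sign_eq_cyc0_Sym0:
  assumes "\<alpha> \<in> Sym0 n"
  shows "sign \<alpha> = (-1) ^ (n + cyc0 {0..n} \<alpha>)"
  using sign_eq_cyc0(1)[of "{0..n}" \<alpha>] assms by (simp add: Sym0_def)

text \<open>The cycle through \<open>0\<close> is not counted, so there are at most \<open>n\<close> counted cycles and the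
  subtraction in \<^const>\<open>plen\<close> is a true one. This is what turns \<open>R\<close> into multiplication by a
  group homomorphism.\<close>

lemma sign_eq_plen:
  assumes "\<alpha> \<in> Sym0 n"
  shows "(-1) ^ plen n \<alpha> = sign \<alpha>"
proof -
  have "cyc0 {0..n} \<alpha> \<le> n"
    using sign_eq_cyc0(2)[of "{0..n}" \<alpha>] assms by (simp add: Sym0_def)
  then have "even (plen n \<alpha>) \<longleftrightarrow> even (n + cyc0 {0..n} \<alpha>)"
    unfolding plen_def by (auto simp: even_diff_nat)
  then show ?thesis
    unfolding sign_eq_cyc0_Sym0[OF assms] by (simp add: minus_one_power_iff)
qed

text \<open>Each pair of a matching is one transposition; the induction undoes the pairs one by one.\<close>

lemma involution_sign_card:
  assumes "\<pi> permutes A" "finite A" "\<pi> \<circ> \<pi> = id"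
  shows "sign \<pi> = (-1) ^ npairs \<pi> \<and> card (psupp \<pi>) = 2 * npairs \<pi>"
  using assms
proof (induction "npairs \<pi>" arbitrary: \<pi>)
  case 0
  have "{i. i < \<pi> i} \<subseteq> A" using 0 by (auto dest: permutes_not_in)
  then have "finite {i. i < \<pi> i}" using 0 finite_subset by blast
  then have none: "\<not> i < \<pi> i" for i using 0 by (auto simp: npairs_def)
  have "\<pi> i = i" for i
    using none[of i] none[of "\<pi> i"] 0(4) by (auto simp: fun_eq_iff)
  then have "\<pi> = id" by auto
  then show ?case by (simp add: npairs_def psupp_def)
next
  case (Suc l)
  have inv: "\<pi> (\<pi> i) = i" for i using Suc.prems(3) by (auto simp: fun_eq_iff)
  have sub: "{i. i < \<pi> i} \<subseteq> A" using Suc.prems by (auto dest: permutes_not_in)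
  then have fin: "finite {i. i < \<pi> i}" using Suc.prems finite_subset by blast
  have "{i. i < \<pi> i} \<noteq> {}" using Suc.hyps(2) by (metis card.empty npairs_def nat.simps(3))
  then obtain i where i: "i < \<pi> i" by auto
  let ?j = "\<pi> i"
  define \<pi>' where "\<pi>' = Transposition.transpose i ?j \<circ> \<pi>"
  have \<pi>': "\<pi>' k = (if k = i \<or> k = ?j then k else \<pi> k)" for k
  proof (cases "k = i \<or> k = ?j")
    case True
    then show ?thesis using inv[of i] by (auto simp: \<pi>'_def)
  next
    case False
    then have "\<pi> k \<noteq> i" "\<pi> k \<noteq> ?j" using inv[of k] inv[of i] by metis+
    then show ?thesis using False by (simp add: \<pi>'_def)
  qed
  have iA: "i \<in> A" "?j \<in> A" using i sub Suc.prems(1) by (auto simp: permutes_in_image)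
  have perm: "\<pi>' permutes A"
    unfolding \<pi>'_def using Suc.prems(1) iA by (intro permutes_compose permutes_swap_id)
  have inv': "\<pi>' \<circ> \<pi>' = id"
  proof
    fix k
    have "k \<noteq> i \<Longrightarrow> k \<noteq> ?j \<Longrightarrow> \<pi> k \<noteq> i \<and> \<pi> k \<noteq> ?j" using inv[of k] inv[of i] by metis
    then show "(\<pi>' \<circ> \<pi>') k = id k" by (auto simp: \<pi>' inv)
  qed
  have "{k. k < \<pi>' k} = {k. k < \<pi> k} - {i}"
    using i by (auto simp: \<pi>' inv)
  then have np: "npairs \<pi>' = l"
    using Suc.hyps(2) i fin by (simp add: npairs_def)
  have IH: "sign \<pi>' = (-1) ^ l" "card (psupp \<pi>') = 2 * l"
    using Suc.hyps(1)[OF np[symmetric] perm Suc.prems(2) inv'] np by auto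
  have "sign \<pi>' = - sign \<pi>"
    unfolding \<pi>'_def using i Suc.prems
    by (simp add: sign_compose permutation_swap_id sign_swap_id permutes_imp_permutation)
  moreover have "psupp \<pi> = insert i (insert ?j (psupp \<pi>'))"
    using i by (auto simp: psupp_def \<pi>' inv)
  moreover have "i \<notin> psupp \<pi>'" "?j \<notin> psupp \<pi>'" by (auto simp: psupp_def \<pi>')
  moreover have "finite (psupp \<pi>')"
    by (rule finite_subset[OF _ Suc.prems(2)]) (use perm in \<open>auto simp: psupp_def dest: permutes_not_in\<close>)
  ultimately show ?case using IH i Suc.hyps(2)[symmetric] by simp
qed

lemma P12_properties:
  assumes "\<pi> \<in> P12 n"
  shows P12_Sym0: "\<pi> \<in> Sym0 n" and sign_P12: "sign \<pi> = (-1) ^ npairs \<pi>"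
    and card_psupp: "card (psupp \<pi>) = 2 * npairs \<pi>"
    and psupp_subset: "psupp \<pi> \<subseteq> {1..n}" and npairs_le: "2 * npairs \<pi> \<le> n"
proof -
  have p: "\<pi> permutes {1..n}" "\<pi> \<circ> \<pi> = id" using assms by (auto simp: P12_def)
  show "\<pi> \<in> Sym0 n" using p Sym1_subset_Sym0 by (auto simp: Sym1_def)
  show c: "sign \<pi> = (-1) ^ npairs \<pi>" "card (psupp \<pi>) = 2 * npairs \<pi>"
    using involution_sign_card[OF p(1) _ p(2)] by auto
  show s: "psupp \<pi> \<subseteq> {1..n}" using p(1) by (auto simp: psupp_def permutes_def)
  show "2 * npairs \<pi> \<le> n" using card_mono[OF _ s] c(2) by simp
qed

text \<open>Only injectivity of the first-return map has to be seen: if the returns of \<open>x\<close> and \<open>y\<close> meet and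
  that of \<open>y\<close> takes longer, then, \<open>p\<close> being injective, \<open>y\<close> has already passed through \<open>x\<close>, which
  lies outside \<open>S\<close>, against the minimality of the return time.\<close>

lemma restrict_perm_permutes:
  assumes p: "p permutes A" and A: "finite A"
  shows "restrict_perm S p permutes (A - S)"
proof -
  define ret where "ret x = (LEAST j. 0 < j \<and> (p ^^ j) x \<notin> S)" for x
  have r: "restrict_perm S p x = (if x \<in> S then x else (p ^^ ret x) x)" for x
    by (simp add: restrict_perm_def ret_def)
  have perm: "permutation p" using p A by (rule permutes_imp_permutation[rotated])
  have ret: "0 < ret x" "(p ^^ ret x) x \<notin> S" if x: "x \<notin> S" for x
  proof -
    have "x \<in> orbit p x" by (rule permutation_self_in_orbit[OF perm])
    then obtain n where "0 < n" "(p ^^ n) x = x" by (auto simp: orbit_altdef)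
    then have "\<exists>j. 0 < j \<and> (p ^^ j) x \<notin> S" using x by auto
    then show "0 < ret x" "(p ^^ ret x) x \<notin> S"
      unfolding ret_def by (metis (mono_tags, lifting) LeastI_ex)+
  qed
  have min: "(p ^^ j) x \<in> S" if "0 < j" "j < ret x" for j x
    using that not_less_Least unfolding ret_def by blast
  have inA: "(p ^^ j) x \<in> A \<longleftrightarrow> x \<in> A" for j x
    by (induction j) (use p in \<open>auto simp: permutes_in_image\<close>)
  have inj: "inj (p ^^ j)" for j
    using p by (simp add: inj_fn permutes_inj)
  have no_gap: "ret y \<le> ret x" if "x \<notin> S" "y \<notin> S" "(p ^^ ret x) x = (p ^^ ret y) y" for x y
  proof (rule ccontr)
    assume "\<not> ret y \<le> ret x"
    then have lt: "ret x < ret y" by simp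
    then have "(p ^^ ret x) ((p ^^ (ret y - ret x)) y) = (p ^^ ret x) x"
      using that(3) by (metis add_diff_inverse_nat comp_apply funpow_add less_imp_not_less)
    then have "(p ^^ (ret y - ret x)) y = x" using inj by (meson injD)
    then show False using min[of "ret y - ret x" y] lt that(1) ret(1)[OF that(1)] by auto
  qed
  have "inj_on (restrict_perm S p) (A - S)"
  proof (rule inj_onI)
    fix x y assume xy: "x \<in> A - S" "y \<in> A - S" "restrict_perm S p x = restrict_perm S p y"
    then have eq: "(p ^^ ret x) x = (p ^^ ret y) y" by (simp add: r)
    then have "ret x = ret y" using no_gap xy by (metis DiffE le_antisym)
    then show "x = y" using eq inj by (metis injD)
  qed
  moreover have "restrict_perm S p ` (A - S) \<subseteq> A - S"
    using ret by (auto simp: r inA)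
  ultimately have "bij_betw (restrict_perm S p) (A - S) (A - S)"
    using A by (simp add: bij_betw_def endo_inj_surj)
  moreover have "restrict_perm S p x = x" if "x \<notin> A - S" for x
  proof (cases "x \<in> S")
    case False
    then have x: "p x = x" using that p by (auto simp: permutes_not_in)
    have "(p ^^ j) x = x" for j by (induction j) (auto simp: x)
    then show ?thesis by (simp add: r)
  qed (simp add: r)
  ultimately show ?thesis by (rule bij_imp_permutes)
qed

text \<open>Relabelling is transport of a permutation along a bijection, and this keeps the sign.
  What remains is that the increasing enumeration of the complement of \<open>S\<close> matches an initial
  segment with the points up to \<open>n\<close>.\<close>

lemma relabel_permutes_sign:
  assumes S: "S \<subseteq> {1..n}" and b: "\<beta> permutes ({0..n} - S)"
  shows "relabel S \<beta> permutes {0..n - card S}" "sign (relabel S \<beta>) = sign \<beta>"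
proof -
  define e where "e = enumerate (- S)"
  have finS: "finite S" using S finite_subset by blast
  then have inf: "infinite (- S)" by simp
  have bij: "bij_betw e UNIV (- S)" unfolding e_def by (rule bij_enumerate[OF inf])
  have inje: "inj e" using bij by (simp add: bij_betw_def)
  define m where "m = n - card S"
  define B where "B = {k. e k \<le> n}"
  have img: "e ` B = {0..n} - S"
  proof (intro equalityI subsetI)
    fix x assume x: "x \<in> {0..n} - S"
    then obtain k where "x = e k" using bij by (metis DiffD2 ComplI bij_betw_iff_bijections)
    then show "x \<in> e ` B" using x by (auto simp: B_def)
  qed (use bij in \<open>auto simp: B_def bij_betw_def\<close>)
  have "card S \<le> n" using card_mono[OF _ S] by simp
  then have "card ({0..n} - S) = Suc m"
    using S finS by (subst card_Diff_subset) (auto simp: m_def)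
  then have cardB: "card B = Suc m"
    using img inje by (metis card_image inj_on_subset subset_UNIV)
  then have finB: "finite B" by (metis card.infinite nat.simps(3))
  have down: "k \<in> B" if "l \<in> B" "k \<le> l" for k l
  proof -
    have "e k \<le> e l" using that(2) inf by (simp add: e_def)
    then show ?thesis using that(1) by (simp add: B_def)
  qed
  have "B = {0..m}"
  proof -
    have "B \<noteq> {}" using cardB by auto
    then have "B = {0..Max B}"
      using down[OF Max_in[OF finB]] Max_ge[OF finB] by auto
    moreover from this have "card B = Suc (Max B)" by (metis card_atLeastAtMost diff_zero)
    ultimately show ?thesis using cardB by simp
  qed
  moreover have "bij_betw (inv e) (e ` B) B"
    by (rule bij_betw_byWitness[where f' = e]) (use inje in auto)
  ultimately have bijB: "bij_betw (inv e) ({0..n} - S) {0..m}"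
    using img by simp
  have "relabel S \<beta> = map_permutation ({0..n} - S) (inv e) \<beta>"
  proof
    fix k
    show "relabel S \<beta> k = map_permutation ({0..n} - S) (inv e) \<beta> k"
    proof (cases "k \<in> {0..m}")
      case True
      then have ek: "e k \<in> {0..n} - S" using \<open>B = {0..m}\<close> img by blast
      have "inv_into ({0..n} - S) (inv e) k = e k"
        using inv_into_f_f[OF bij_betw_imp_inj_on[OF bijB] ek] inje by simp
      then show ?thesis
        using True bijB by (simp add: relabel_def map_permutation_def e_def[symmetric] bij_betw_def restrict_id_def)
    next
      case False
      then have "e k \<notin> {0..n} - S" using \<open>B = {0..m}\<close> by (auto simp: B_def)
      then have "\<beta> (e k) = e k" using b by (simp add: permutes_not_in)
      then show ?thesis
        using False bijB inje by (simp add: relabel_def map_permutation_def e_def[symmetric] bij_betw_def restrict_id_def)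
    qed
  qed
  then show "relabel S \<beta> permutes {0..n - card S}" "sign (relabel S \<beta>) = sign \<beta>"
    using map_permutation_permutes[OF bijB b] sign_map_permutation[OF bij_betw_imp_inj_on[OF bijB] b]
    by (simp_all add: m_def)
qed

lemma contr_perm_Sym0:
  assumes "\<alpha> \<in> Sym0 n" "\<pi> \<in> P12 n"
  shows "contr_perm \<pi> \<alpha> \<in> Sym0 (n - 2 * npairs \<pi>)"
proof -
  have "(\<pi> \<circ> \<alpha>) permutes {0..n}"
    using Sym0_comp[OF P12_Sym0[OF assms(2)] assms(1)] by (simp add: Sym0_def)
  then have "restrict_perm (psupp \<pi>) (\<pi> \<circ> \<alpha>) permutes ({0..n} - psupp \<pi>)"
    by (intro restrict_perm_permutes) auto
  from relabel_permutes_sign(1)[OF psupp_subset[OF assms(2)] this]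
  show ?thesis using card_psupp[OF assms(2)] by (simp add: contr_perm_def Sym0_def)
qed

text \<open>The combinatorial core. With \<open>\<rho>\<close> the first-return permutation of \<open>\<pi>\<alpha>\<close>, the cycle formula
  for signs turns the exponent of \<open>q\<close>, modulo \<open>2\<close>, into the comparison of \<open>sign \<rho>\<close> with
  \<open>sign (\<pi>\<alpha>)\<close> and \<open>sign \<pi>\<close>: deleting \<open>2\<ell>\<close> points does not change the parity of the number of
  points, and the summand \<open>\<ell>\<close> is what \<open>sign \<pi> = (-1)\<^sup>\<ell>\<close> cancels. Hence replacing \<open>q\<close> by \<open>-q\<close>
  costs exactly the ratio of the signs of \<open>\<alpha>\<close> and of its contraction.\<close>

lemma contr_coeff_minus:
  assumes \<alpha>: "\<alpha> \<in> Sym0 n" and \<pi>: "\<pi> \<in> P12 n"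
  shows "contr_coeff (- q) n \<pi> \<alpha> * sign \<alpha> = contr_coeff q n \<pi> \<alpha> * sign (contr_perm \<pi> \<alpha>)"
proof -
  note P = P12_properties[OF \<pi>]
  define \<rho> where "\<rho> = restrict_perm (psupp \<pi>) (\<pi> \<circ> \<alpha>)"
  let ?A = "{0..n} - psupp \<pi>"
  define r where "r = cyc0 ?A \<rho>"
  define c where "c = cyc0 {0..n} (\<pi> \<circ> \<alpha>)"
  define l where "l = npairs \<pi>"
  have pa: "\<pi> \<circ> \<alpha> \<in> Sym0 n" by (rule Sym0_comp[OF P(1) \<alpha>])
  have rho: "\<rho> permutes ?A"
    unfolding \<rho>_def using pa by (intro restrict_perm_permutes) (auto simp: Sym0_def)
  have "finite (psupp \<pi>)" using P(4) finite_subset by blast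
  then have card: "card ?A - 1 = n - 2 * l"
    using P(3,4) by (subst card_Diff_subset) (auto simp: l_def)
  have "sign (contr_perm \<pi> \<alpha>) = sign \<rho>"
    unfolding contr_perm_def \<rho>_def[symmetric] by (rule relabel_permutes_sign(2)[OF P(4) rho])
  also have "\<dots> = (-1) ^ (n - 2 * l + r)"
    unfolding r_def card[symmetric] using P(4) by (intro sign_eq_cyc0(1)[OF _ _ rho]) auto
  finally have s1: "sign (contr_perm \<pi> \<alpha>) = (-1) ^ (n + r)"
    using P(5) by (simp add: minus_one_power_iff l_def)
  have "sign \<pi> * sign \<alpha> = (-1) ^ (n + c)"
    using sign_eq_cyc0_Sym0[OF pa] sign_comp[OF P(1) \<alpha>] by (simp add: c_def)
  then have "sign \<pi> * (sign \<pi> * sign \<alpha>) = (-1) ^ l * (-1) ^ (n + c)"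
    using P(2) by (simp add: l_def)
  then have s2: "sign \<alpha> = (-1) ^ (l + n + c)"
    by (simp add: power_add)
  have "contr_coeff (- q) n \<pi> \<alpha> = (-1 * q) powi (int r - int c + int l)"
    by (simp add: contr_coeff_def r_def c_def l_def \<rho>_def)
  also have "\<dots> = (-1) powi (int r - int c + int l) * contr_coeff q n \<pi> \<alpha>"
    unfolding power_int_mult_distrib by (simp add: contr_coeff_def r_def c_def l_def \<rho>_def)
  also have "(-1::real) powi (int r - int c + int l) = (-1) ^ (r + c + l)"
    by (simp add: power_int_add power_int_diff power_add minus_one_power_iff)
  finally show ?thesis
    unfolding s1 s2
    by (cases "even r"; cases "even c"; cases "even l"; cases "even n"; simp add: minus_one_power_iff)
qed

text \<open>A shift is again transport along an injection, this time the one that fixes \<open>0\<close> and moves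
  \<open>j \<ge> 1\<close> to \<open>n + j\<close>.\<close>

lemma shift_perm_Sym0_sign:
  assumes "\<beta> \<in> Sym0 k"
  shows "shift_perm n \<beta> \<in> Sym0 (n + k)" "sign (shift_perm n \<beta>) = sign \<beta>"
proof -
  define f where "f j = (if j = 0 then 0 else n + j)" for j :: nat
  have b: "\<beta> permutes {0..k}" using assms by (simp add: Sym0_def)
  have inj: "inj f" by (auto simp: f_def inj_def)
  let ?A = "{0..k}"
  have injA: "inj_on f ?A" using inj inj_on_subset by blast
  have img: "f j \<in> f ` ?A \<longleftrightarrow> j \<in> ?A" for j using inj by (simp add: inj_image_mem_iff)
  have "shift_perm n \<beta> = map_permutation ?A f \<beta>"
  proof
    fix x
    have val: "map_permutation ?A f \<beta> (f j) = f (\<beta> j)" for j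
      using img[of j] injA b by (auto simp: map_permutation_def restrict_id_def permutes_not_in)
    show "shift_perm n \<beta> x = map_permutation ?A f \<beta> x"
    proof (cases "x \<in> {1..n}")
      case True
      then have "x \<notin> f ` ?A" by (auto simp: f_def)
      then show ?thesis using True by (auto simp: shift_perm_def map_permutation_def restrict_id_def)
    next
      case False
      then have "x = f (if x = 0 then 0 else x - n)" by (auto simp: f_def)
      moreover have "shift_perm n \<beta> x = f (\<beta> (if x = 0 then 0 else x - n))"
        using False by (auto simp: shift_perm_def f_def Let_def)
      ultimately show ?thesis using val by metis
    qed
  qed
  moreover have "map_permutation ?A f \<beta> permutes f ` ?A"
    using injA b by (intro map_permutation_permutes) (auto simp: bij_betw_def)
  moreover have "f ` ?A \<subseteq> {0..n + k}" by (auto simp: f_def)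
  ultimately show "shift_perm n \<beta> \<in> Sym0 (n + k)" "sign (shift_perm n \<beta>) = sign \<beta>"
    using sign_map_permutation[OF injA b] by (auto simp: Sym0_def intro: permutes_subset)
qed

lemma perm_cup_Sym0_sign:
  assumes "\<alpha> \<in> Sym0 n" "\<beta> \<in> Sym0 k"
  shows "perm_cup n \<alpha> \<beta> \<in> Sym0 (n + k)" "sign (perm_cup n \<alpha> \<beta>) = sign \<alpha> * sign \<beta>"
proof -
  have a: "\<alpha> \<in> Sym0 (n + k)"
    using assms(1) by (auto simp: Sym0_def elim: permutes_subset)
  note s = shift_perm_Sym0_sign[OF assms(2), of n]
  show "perm_cup n \<alpha> \<beta> \<in> Sym0 (n + k)" "sign (perm_cup n \<alpha> \<beta>) = sign \<alpha> * sign \<beta>"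
    unfolding perm_cup_def using Sym0_comp[OF s(1) a] sign_comp[OF s(1) a] s(2) by simp_all
qed

section \<open>Linearity of symmetrized tensors\<close>

lemma tperm_add: "tperm \<sigma> (F + G) = tperm \<sigma> F + tperm \<sigma> G"
  by (auto simp: tperm_def fun_eq_iff)

lemma tperm_scale: "tperm \<sigma> (tscale c F) = tscale c (tperm \<sigma> F)"
  by (auto simp: tperm_def tscale_def)

lemma pure_add: "pure n \<alpha> (F + G) = pure n \<alpha> F + pure n \<alpha> G"
  by (auto simp: pure_def fun_eq_iff)

lemma pure_scale: "pure n \<alpha> (tscale c F) = pscale c (pure n \<alpha> F)"
  by (auto simp: pure_def pscale_def fun_eq_iff)

lemma sym_pure_add: "sym_pure n \<alpha> (F + G) = sym_pure n \<alpha> F + sym_pure n \<alpha> G"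
  unfolding sym_pure_def tperm_add pure_add by (simp add: sum.distrib pt.scale_right_distrib)

lemma sym_pure_scale: "sym_pure n \<alpha> (tscale c F) = pscale c (sym_pure n \<alpha> F)"
  unfolding sym_pure_def tperm_scale pure_scale
  by (simp add: pt.scale_sum_right pt.scale_left_commute)

lemma sym_pure_0 [simp]: "sym_pure n \<alpha> 0 = 0"
  using sym_pure_scale[of n \<alpha> 0 0] by simp

lemma ptensor_sum_apply: "(\<Sum>k\<in>A. f k) n \<alpha> = (\<Sum>k\<in>A. f k n \<alpha>)" for f :: "'a \<Rightarrow> 'h ptensor"
  by (simp add: sum_fun_apply)

lemma sym_pure_degree: "sym_pure n \<alpha> F m \<beta> = 0" if "m \<noteq> n"
  using that unfolding sym_pure_def pscale_def by (simp add: ptensor_sum_apply pure_def)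

lemma sym_pure_degree': "sym_pure n \<alpha> F m = 0" if "m \<noteq> n"
  using sym_pure_degree[OF that] by (auto simp: fun_eq_iff)

lemma finite_Sym0 [simp]: "finite (Sym0 n)"
  unfolding Sym0_def by (rule finite_permutations) simp

lemma finite_Sym1 [simp]: "finite (Sym1 n)"
  unfolding Sym1_def by (rule finite_permutations) simp

lemma finite_P12 [simp]: "finite (P12 n)"
  by (rule finite_subset[OF _ finite_Sym1[of n]]) (auto simp: P12_def Sym1_def)

lemma id_P12: "id \<in> P12 n"
  by (simp add: P12_def permutes_id)

section \<open>Algebraic tensors\<close>

text \<open>Contractions are defined through representations of a tensor as a finite sum of simple
  tensors. They are linear on the algebraic tensors only, which is why membership of the coefficients
  in \<^const>\<open>calg_tensors\<close> is followed through all constructions below.\<close>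

lemma calg_sum_repE:
  assumes "F \<in> calg_tensors n"
  obtains m c hs where "\<forall>k<m. length (hs k) = n"
    "F = (\<Sum>k<m::nat. tscale (c k) (simple_tensor (hs k)))"
proof -
  have "\<exists>m c hs. (\<forall>k<m. length (hs k) = n) \<and>
      F = (\<Sum>k<m::nat. tscale (c k) (simple_tensor (hs k)))"
    using assms unfolding calg_tensors_def
  proof (induction rule: ctens.span_induct_alt)
    case base
    show ?case by (rule exI[of _ 0]) auto
  next
    case (step a x G)
    then obtain m c hs g where h: "\<forall>k<m. length (hs k) = n"
      "G = (\<Sum>k<m::nat. tscale (c k) (simple_tensor (hs k)))" "length g = n" "x = simple_tensor g"
      by blast
    show ?case
      by (rule exI[of _ "Suc m"], rule exI[of _ "c(m := a)"], rule exI[of _ "hs(m := g)"])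
        (use h in \<open>auto simp: less_Suc_eq add.commute\<close>)
  qed
  then show ?thesis using that by blast
qed

lemma calg_subspace: "ctens.subspace (calg_tensors n)"
  unfolding calg_tensors_def by (rule ctens.subspace_span)

lemmas calg_0 = ctens.subspace_0[OF calg_subspace]
  and calg_add = ctens.subspace_add[OF calg_subspace]
  and calg_scale = ctens.subspace_scale[OF calg_subspace]
  and calg_sum = ctens.subspace_sum[OF calg_subspace]

lemma calg_simple: "length hs = n \<Longrightarrow> simple_tensor hs \<in> calg_tensors n"
  unfolding calg_tensors_def by (auto intro: ctens.span_base)

lemma calg_induct [consumes 1, case_names zero add]:
  assumes "F \<in> calg_tensors n" "P 0"
    "\<And>c hs F. length hs = n \<Longrightarrow> F \<in> calg_tensors n \<Longrightarrow> P F \<Longrightarrow> P (tscale c (simple_tensor hs) + F)"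
  shows "P F"
proof -
  have "F \<in> calg_tensors n \<and> P F"
    using assms(1) unfolding calg_tensors_def
  proof (induction rule: ctens.span_induct_alt)
    case base
    show ?case by (intro conjI assms(2) ctens.span_zero)
  next
    case (step c x G)
    then obtain hs where hs: "length hs = n" "x = simple_tensor hs" by blast
    then have "P (tscale c x + G)"
      using assms(3)[of hs G c] step.IH by (simp only: calg_tensors_def hs)
    moreover have "tscale c x + G \<in> ctens.span (simple_tensor ` {hs. length hs = n})"
      using step by (blast intro: ctens.span_add ctens.span_scale ctens.span_base)
    ultimately show ?case by blast
  qed
  then show ?thesis ..
qed

lemma ralg_subset_calg: "ralg_tensors n \<subseteq> calg_tensors n"
  unfolding ralg_tensors_def
proof (rule rtens.span_minimal)
  show "simple_tensor ` {hs. length hs = n} \<subseteq> calg_tensors n" by (auto simp: calg_simple)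
  show "rtens.subspace (calg_tensors n)"
    by (auto simp: rtens.subspace_def calg_0 calg_add calg_scale)
qed

lemma calg_length:
  assumes "F \<in> calg_tensors n" "length xs \<noteq> n"
  shows "F xs = 0"
  using assms(1) by (induction rule: calg_induct) (use assms(2) in \<open>auto simp: tscale_def simple_tensor_def\<close>)

lemma calg_cnj:
  assumes "F \<in> calg_tensors n"
  shows "(\<lambda>xs. cnj (F xs)) \<in> calg_tensors n"
  using assms
proof (induction rule: calg_induct)
  case zero
  then show ?case using calg_0[of n] by (simp add: zero_fun_def)
next
  case (add c hs F)
  have "(\<lambda>xs. cnj ((tscale c (simple_tensor hs) + F) xs)) =
      tscale (cnj c) (simple_tensor hs) + (\<lambda>xs. cnj (F xs))"
    by (auto simp: tscale_def simple_tensor_def fun_eq_iff simp del: of_real_prod)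
  then show ?case using add by (simp add: calg_add calg_scale calg_simple)
qed

lemma prod_lessThan_add:
  "(\<Prod>i<m + k. f i) = (\<Prod>i<m. f i) * (\<Prod>i<k. f (m + i))" for f :: "nat \<Rightarrow> 'a::comm_monoid_mult"
  by (induction k) (simp_all add: mult.assoc)

lemma tprod_simple:
  "tprod (length hs) (simple_tensor hs) (simple_tensor gs) = simple_tensor (hs @ gs)"
proof
  fix xs :: "'a list"
  show "tprod (length hs) (simple_tensor hs) (simple_tensor gs) xs = simple_tensor (hs @ gs) xs"
  proof (cases "length xs = length hs + length gs")
    case True
    have "(\<Prod>i<length hs + length gs. inner ((hs @ gs) ! i) (xs ! i)) =
        (\<Prod>i<length hs. inner ((hs @ gs) ! i) (xs ! i)) *
        (\<Prod>i<length gs. inner ((hs @ gs) ! (length hs + i)) (xs ! (length hs + i)))"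
      by (rule prod_lessThan_add)
    then show ?thesis using True
      by (simp add: tprod_def simple_tensor_def nth_append)
  qed (auto simp: tprod_def simple_tensor_def)
qed

lemma tprod_add_left: "tprod n (F + F') G = tprod n F G + tprod n F' G"
  and tprod_add_right: "tprod n F (G + G') = tprod n F G + tprod n F G'"
  and tprod_scale_left: "tprod n (tscale c F) G = tscale c (tprod n F G)"
  and tprod_scale_right: "tprod n F (tscale c G) = tscale c (tprod n F G)"
  and tprod_0_left: "tprod n 0 G = 0"
  and tprod_0_right: "tprod n F 0 = 0"
  by (auto simp: tprod_def tscale_def fun_eq_iff algebra_simps)

lemma calg_tprod:
  assumes "F \<in> calg_tensors n" "G \<in> calg_tensors k"
  shows "tprod n F G \<in> calg_tensors (n + k)"
  using assms(1)
proof (induction rule: calg_induct)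
  case zero
  show ?case unfolding tprod_0_left by (rule calg_0)
next
  case (add c hs F)
  have "tprod n (simple_tensor hs) G \<in> calg_tensors (n + k)"
    using assms(2)
  proof (induction rule: calg_induct)
    case zero
    show ?case unfolding tprod_0_right by (rule calg_0)
  next
    case (add d gs G)
    then show ?case using \<open>length hs = n\<close> tprod_simple[of hs gs]
      unfolding tprod_add_right tprod_scale_right
      by (intro calg_add calg_scale) (simp_all add: calg_simple)
  qed
  then show ?case
    unfolding tprod_add_left tprod_scale_left by (intro calg_add calg_scale add.IH)
qed

lemma tperm_simple:
  assumes \<sigma>: "\<sigma> \<in> Sym1 n" and len: "length hs = n"
  shows "tperm \<sigma> (simple_tensor hs) = simple_tensor (map (\<lambda>j. hs ! (inv \<sigma> (Suc j) - 1)) [0..<n])"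
proof
  fix xs :: "'a list"
  have p: "\<sigma> permutes {1..n}" using \<sigma> by (simp add: Sym1_def)
  have q: "inv \<sigma> permutes {1..n}" using p by (rule permutes_inv)
  have r1: "\<tau> (Suc i) \<in> {1..n}" if "\<tau> permutes {1..n}" "i < n" for \<tau> i
    using that permutes_in_image[of \<tau> "{1..n}" "Suc i"] by auto
  have "(\<Prod>i<n. inner (hs ! i) (xs ! (\<sigma> (Suc i) - 1))) =
      (\<Prod>i<n. inner (hs ! (inv \<sigma> (Suc i) - 1)) (xs ! i))"
    by (rule prod.reindex_bij_witness[of _ "\<lambda>i. inv \<sigma> (Suc i) - 1" "\<lambda>i. \<sigma> (Suc i) - 1"])
      (use r1[OF p] r1[OF q] permutes_inverses[OF p] in force)+
  then show "tperm \<sigma> (simple_tensor hs) xs = simple_tensor (map (\<lambda>j. hs ! (inv \<sigma> (Suc j) - 1)) [0..<n]) xs"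
    using len by (simp add: tperm_def simple_tensor_def del: of_real_prod)
qed

lemma calg_tperm:
  assumes "F \<in> calg_tensors n" "\<sigma> \<in> Sym1 n"
  shows "tperm \<sigma> F \<in> calg_tensors n"
  using assms(1)
proof (induction rule: calg_induct)
  case zero
  have "tperm \<sigma> 0 = (0 :: 'a tensor)" by (auto simp: tperm_def)
  then show ?case using calg_0[of n] by (simp only:)
next
  case (add c hs F)
  then show ?case
    unfolding tperm_add tperm_scale tperm_simple[OF assms(2) add.hyps(1)]
    by (intro calg_add calg_scale calg_simple) simp_all
qed

text \<open>\<open>U\<^sub>\<tau> U\<^sub>\<sigma> = U\<^sub>\<tau>\<^sub>\<sigma>\<close> on lists of length \<open>n\<close>, where \<open>\<sigma>\<close> permutes the positions; on other lists both
  sides vanish because \<open>F\<close> does.\<close>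

lemma tperm_comp:
  assumes F: "F \<in> calg_tensors n" and s: "\<sigma> \<in> Sym1 n"
  shows "tperm \<tau> (tperm \<sigma> F) = tperm (\<tau> \<circ> \<sigma>) F"
proof
  fix xs :: "'a list"
  show "tperm \<tau> (tperm \<sigma> F) xs = tperm (\<tau> \<circ> \<sigma>) F xs"
  proof (cases "length xs = n")
    case True
    have \<sigma>: "\<sigma> (Suc i) - 1 < n \<and> Suc (\<sigma> (Suc i) - 1) = \<sigma> (Suc i)" if "i < n" for i
    proof -
      have "\<sigma> (Suc i) \<in> {1..n}"
        using s that permutes_in_image[of \<sigma> "{1..n}" "Suc i"] by (auto simp: Sym1_def)
      then show ?thesis by auto
    qed
    have "map (\<lambda>j. map (\<lambda>j. xs ! (\<tau> (Suc j) - 1)) [0..<n] ! (\<sigma> (Suc j) - 1)) [0..<n] =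
        map (\<lambda>j. xs ! (\<tau> (\<sigma> (Suc j)) - 1)) [0..<n]"
      using \<sigma> by (intro map_cong refl) (simp del: One_nat_def)
    then have "F (map (\<lambda>j. map (\<lambda>j. xs ! (\<tau> (Suc j) - 1)) [0..<n] ! (\<sigma> (Suc j) - 1)) [0..<n]) =
        F (map (\<lambda>j. xs ! (\<tau> (\<sigma> (Suc j)) - 1)) [0..<n])"
      by (rule arg_cong)
    then show ?thesis using True by (simp add: tperm_def)
  next
    case False
    then show ?thesis unfolding tperm_def by (simp add: calg_length[OF F])
  qed
qed

text \<open>Representations of \<open>F\<close> and \<open>G\<close> are concatenated to one of \<open>F + G\<close>.\<close>

lemma contr_add:
  assumes \<pi>: "\<pi> \<in> P12 n" and "F \<in> calg_tensors n" "G \<in> calg_tensors n"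
  shows "contr n \<pi> (F + G) = contr n \<pi> F + contr n \<pi> G"
proof -
  obtain m c hs where F: "\<forall>k<m. length (hs k) = n" "F = (\<Sum>k<m::nat. tscale (c k) (simple_tensor (hs k)))"
    using assms(2) by (rule calg_sum_repE)
  obtain m' c' hs' where G: "\<forall>k<m'. length (hs' k) = n" "G = (\<Sum>k<m'::nat. tscale (c' k) (simple_tensor (hs' k)))"
    using assms(3) by (rule calg_sum_repE)
  define d where "d k = (if k < m then c k else c' (k - m))" for k
  define gs where "gs k = (if k < m then hs k else hs' (k - m))" for k
  have join: "(\<Sum>k<m + m'. tscale (d k) (f (gs k))) =
      (\<Sum>k<m. tscale (c k) (f (hs k))) + (\<Sum>k<m'. tscale (c' k) (f (hs' k)))" for f :: "'a list \<Rightarrow> 'a tensor"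
  proof -
    have "(\<Sum>k<m + j. tscale (d k) (f (gs k))) =
      (\<Sum>k<m. tscale (c k) (f (hs k))) + (\<Sum>k<j. tscale (c' k) (f (hs' k)))" for j
      by (induction j) (simp_all add: d_def gs_def add.assoc)
    then show ?thesis .
  qed
  have "\<forall>k<m + m'. length (gs k) = n" using F(1) G(1) by (auto simp: gs_def)
  from contr_sum[OF \<pi> this, of d] show ?thesis
    unfolding join[of simple_tensor] join[of "contr_simple \<pi>"] by (simp add: F(2) G(2) contr_sum[OF \<pi> F(1)] contr_sum[OF \<pi> G(1)])
qed

lemma contr_scale:
  assumes \<pi>: "\<pi> \<in> P12 n" and "F \<in> calg_tensors n"
  shows "contr n \<pi> (tscale a F) = tscale a (contr n \<pi> F)"
proof -
  obtain m c hs where F: "\<forall>k<m. length (hs k) = n" "F = (\<Sum>k<m::nat. tscale (c k) (simple_tensor (hs k)))"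
    using assms(2) by (rule calg_sum_repE)
  have "tscale a F = (\<Sum>k<m. tscale (a * c k) (simple_tensor (hs k)))"
    unfolding F(2) by (simp add: ctens.scale_sum_right)
  then show ?thesis
    by (simp add: F(2) contr_sum[OF \<pi> F(1)] ctens.scale_sum_right)
qed

lemma contr_0: "\<pi> \<in> P12 n \<Longrightarrow> contr n \<pi> 0 = 0"
  using contr_scale[of \<pi> n 0 0] calg_0[of n] by simp

lemma contr_simple_tensor:
  assumes "\<pi> \<in> P12 n" "length hs = n"
  shows "contr n \<pi> (simple_tensor hs) = contr_simple \<pi> hs"
  using contr_sum[OF assms(1), of "1" "\<lambda>_. hs" "\<lambda>_. 1"] assms(2) by simp

lemma calg_contr:
  assumes \<pi>: "\<pi> \<in> P12 n" and "F \<in> calg_tensors n"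
  shows "contr n \<pi> F \<in> calg_tensors (n - 2 * npairs \<pi>)"
  using assms(2)
proof (induction rule: calg_induct)
  case zero
  show ?case unfolding contr_0[OF \<pi>] by (rule calg_0)
next
  case (add c hs F)
  note P = P12_properties[OF \<pi>]
  have "card {i. i < n \<and> Suc i \<notin> psupp \<pi>} = card ({1..n} - psupp \<pi>)"
    by (rule bij_betw_same_card[of Suc], rule bij_betw_byWitness[where f' = "\<lambda>i. i - 1"]) auto
  also have "\<dots> = n - 2 * npairs \<pi>"
    using P(3,4) finite_subset[OF P(4)] by (subst card_Diff_subset) auto
  finally have "length (nths hs {j. Suc j \<notin> psupp \<pi>}) = n - 2 * npairs \<pi>"
    using add(1) by (simp add: length_nths)
  then have "contr_simple \<pi> hs \<in> calg_tensors (n - 2 * npairs \<pi>)"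
    unfolding contr_simple_def by (intro calg_scale calg_simple)
  then show ?case
    using add.IH
    unfolding contr_add[OF \<pi> calg_scale[OF calg_simple[OF add.hyps(1)]] add.hyps(2)]
      contr_scale[OF \<pi> calg_simple[OF add.hyps(1)]] contr_simple_tensor[OF \<pi> add.hyps(1)]
    by (intro calg_add calg_scale)
qed

lemma contr_id:
  assumes "F \<in> calg_tensors n"
  shows "contr n id F = F"
  using assms
proof (induction rule: calg_induct)
  case zero
  show ?case by (rule contr_0[OF id_P12])
next
  case (add c hs F)
  have "contr_simple id hs = simple_tensor hs"
    by (simp add: contr_simple_def psupp_def nths_all)
  then show ?case
    using add.IH
    unfolding contr_add[OF id_P12 calg_scale[OF calg_simple[OF add.hyps(1)]] add.hyps(2)]
      contr_scale[OF id_P12 calg_simple[OF add.hyps(1)]] contr_simple_tensor[OF id_P12 add.hyps(1)]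
    by (simp only:)
qed

section \<open>The sign map R and the structure maps\<close>

lemma Rmap_add: "Rmap (X + Y) = Rmap X + Rmap Y"
  by (intro ext) (simp add: Rmap_def tscale_def algebra_simps)

lemma Rmap_pscale: "Rmap (pscale c X) = pscale c (Rmap X)"
  by (intro ext) (simp add: Rmap_def tscale_def pscale_def)

lemma Rmap_0: "Rmap 0 = 0"
  using Rmap_pscale[of 0 0] by (simp only: pt.scale_zero_left)

lemma Rmap_sum: "Rmap (\<Sum>k\<in>A. f k) = (\<Sum>k\<in>A. Rmap (f k))"
  by (induction A rule: infinite_finite_induct) (simp_all only: sum.infinite sum.empty sum.insert Rmap_0 Rmap_add not_False_eq_True)

lemma Rmap_Rmap: "Rmap (Rmap X) = X"
  by (intro ext) (simp add: Rmap_def tscale_def flip: power_add mult.assoc)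

lemma minus_one_power_plen:
  "\<alpha> \<in> Sym0 n \<Longrightarrow> (-1) ^ plen n \<alpha> = (of_int (sign \<alpha>) :: 'a::ring_1)"
  by (metis of_int_1 of_int_minus of_int_power sign_eq_plen)

lemma Rmap_apply: "\<alpha> \<in> Sym0 n \<Longrightarrow> Rmap \<Xi> n \<alpha> = tscale (of_int (sign \<alpha>)) (\<Xi> n \<alpha>)"
  unfolding Rmap_def by (simp only: minus_one_power_plen)

lemma Rmap_nonzero: "{n. Rmap \<Xi> n \<noteq> 0} = {n. \<Xi> n \<noteq> 0}"
proof -
  have "Rmap X n = 0" if "X n = 0" for X :: "'a ptensor" and n
    unfolding Rmap_def that by (intro ext) (simp add: tscale_def)
  from this[of \<Xi>] this[of "Rmap \<Xi>"] show ?thesis unfolding Rmap_Rmap by blast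
qed

text \<open>Since the sign is invariant under conjugation, all summands of \<open>\<alpha> \<otimes>\<^sub>s F\<close> are multiplied by the
  same factor.\<close>

lemma Rmap_sym_pure:
  assumes "\<alpha> \<in> Sym0 n"
  shows "Rmap (sym_pure n \<alpha> F) = pscale (of_int (sign \<alpha>)) (sym_pure n \<alpha> F)"
proof -
  have "Rmap (pure n (\<sigma> \<circ> \<alpha> \<circ> inv \<sigma>) G) = pscale (of_int (sign \<alpha>)) (pure n (\<sigma> \<circ> \<alpha> \<circ> inv \<sigma>) G)"
    if s: "\<sigma> \<in> Sym1 n" for \<sigma> and G :: "'a tensor"
  proof -
    note m = Sym1_subset_Sym0[OF s]
    have "sign (\<sigma> \<circ> \<alpha> \<circ> inv \<sigma>) = sign \<alpha>"
      by (simp add: sign_comp[OF Sym0_comp[OF m assms] Sym0_inv[OF m]] sign_comp[OF m assms] sign_inv[OF m])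
    then have "(-1) ^ plen n (\<sigma> \<circ> \<alpha> \<circ> inv \<sigma>) = (of_int (sign \<alpha>) :: complex)"
      unfolding minus_one_power_plen[OF Sym0_conj[OF assms s]] by (simp only:)
    then show ?thesis
      by (intro ext) (auto simp: Rmap_def pscale_def pure_def tscale_def)
  qed
  then show ?thesis
    unfolding sym_pure_def Rmap_pscale Rmap_sum
    by (simp add: pt.scale_sum_right pt.scale_left_commute)
qed

text \<open>Part (i), for all elements with algebraic coefficients: summand by summand it is the identity
  for the contraction coefficients.\<close>

lemma Rmap_Tmap:
  assumes "\<And>n \<alpha>. \<Xi> n \<alpha> \<in> calg_tensors n"
  shows "Rmap (Tmap q \<Xi>) = Tmap (- q) (Rmap \<Xi>)"
  unfolding Tmap_def Rmap_nonzero Rmap_sum Rmap_pscale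
proof (intro sum.cong refl)
  fix n \<alpha> \<pi>
  assume a: "\<alpha> \<in> Sym0 n" and p: "\<pi> \<in> P12 n"
  have "complex_of_real (contr_coeff q n \<pi> \<alpha> * sign (contr_perm \<pi> \<alpha>)) =
      complex_of_real (contr_coeff (- q) n \<pi> \<alpha> * sign \<alpha>)"
    unfolding contr_coeff_minus[OF a p] by (rule refl)
  then have c: "complex_of_real (contr_coeff q n \<pi> \<alpha>) * of_int (sign (contr_perm \<pi> \<alpha>)) =
      complex_of_real (contr_coeff (- q) n \<pi> \<alpha>) * of_int (sign \<alpha>)"
    by simp
  show "pscale (complex_of_real (contr_coeff q n \<pi> \<alpha>))
        (Rmap (sym_pure (n - 2 * npairs \<pi>) (contr_perm \<pi> \<alpha>) (contr n \<pi> (\<Xi> n \<alpha>)))) =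
      pscale (complex_of_real (contr_coeff (- q) n \<pi> \<alpha>))
        (sym_pure (n - 2 * npairs \<pi>) (contr_perm \<pi> \<alpha>) (contr n \<pi> (Rmap \<Xi> n \<alpha>)))"
    unfolding Rmap_sym_pure[OF contr_perm_Sym0[OF a p]] Rmap_apply[OF a]
      contr_scale[OF p assms] sym_pure_scale pt.scale_scale c by (rule refl)
qed

text \<open>The sign is multiplicative on \<open>\<alpha> \<union> \<beta>\<close>, so \<open>R\<close> commutes with the product before it is
  transported along \<open>T\<^sup>(\<^sup>q\<^sup>)\<close>.\<close>

lemma Rmap_cup_prod: "Rmap (cup_prod \<Xi> \<Theta>) = cup_prod (Rmap \<Xi>) (Rmap \<Theta>)"
  unfolding cup_prod_def Rmap_nonzero Rmap_sum
proof (intro sum.cong refl)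
  fix n k \<alpha> \<beta>
  assume a: "\<alpha> \<in> Sym0 n" and b: "\<beta> \<in> Sym0 k"
  note c = perm_cup_Sym0_sign[OF a b]
  show "Rmap (sym_pure (n + k) (perm_cup n \<alpha> \<beta>) (tprod n (\<Xi> n \<alpha>) (\<Theta> k \<beta>))) =
      sym_pure (n + k) (perm_cup n \<alpha> \<beta>) (tprod n (Rmap \<Xi> n \<alpha>) (Rmap \<Theta> k \<beta>))"
    unfolding Rmap_sym_pure[OF c(1)] Rmap_apply[OF a] Rmap_apply[OF b]
      tprod_scale_left tprod_scale_right sym_pure_scale pt.scale_scale c(2)
    by (simp only: of_int_mult mult.commute)
qed

lemma Rmap_inv_conj: "Rmap (inv_conj \<Xi>) = inv_conj (Rmap \<Xi>)"
proof (rule ext, rule ext)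
  fix n \<alpha>
  show "Rmap (inv_conj \<Xi>) n \<alpha> = inv_conj (Rmap \<Xi>) n \<alpha>"
  proof (cases "\<alpha> \<in> Sym0 n")
    case True
    show ?thesis
      unfolding Rmap_apply[OF True] inv_conj_def Rmap_apply[OF Sym0_inv[OF True]] sign_inv[OF True]
      using True by (auto simp: tscale_def)
  next
    case False
    then show ?thesis by (auto simp: Rmap_def inv_conj_def tscale_def)
  qed
qed

section \<open>The space spanned by permutations and tensors\<close>

lemma TP_subspace: "pt.subspace TP"
  unfolding TP_def by (rule pt.subspace_span)

lemmas TP_0 = pt.subspace_0[OF TP_subspace]
  and TP_add = pt.subspace_add[OF TP_subspace]
  and TP_diff = pt.subspace_diff[OF TP_subspace]
  and TP_scale = pt.subspace_scale[OF TP_subspace]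
  and TP_sum = pt.subspace_sum[OF TP_subspace]

lemma calg_sym_pure:
  assumes "F \<in> calg_tensors n"
  shows "sym_pure n \<alpha> F m \<beta> \<in> calg_tensors m"
proof -
  have "pure n \<gamma> (tperm \<sigma> F) m \<beta> \<in> calg_tensors m" if "\<sigma> \<in> Sym1 n" for \<sigma> \<gamma>
    using calg_tperm[OF assms that]
    by (cases "m = n \<and> \<beta> = \<gamma>") (simp_all only: pure_def if_True if_False calg_0 simp_thms)
  then show ?thesis
    unfolding sym_pure_def pscale_def ptensor_sum_apply by (intro calg_scale calg_sum)
qed

lemma subspace_calg_coeffs: "pt.subspace {\<Xi>. \<forall>n \<alpha>. \<Xi> n \<alpha> \<in> calg_tensors n}"
proof (rule pt.subspaceI)
  fix x y :: "'a ptensor" and c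
  assume x: "x \<in> {\<Xi>. \<forall>n \<alpha>. \<Xi> n \<alpha> \<in> calg_tensors n}"
  then show "pscale c x \<in> {\<Xi>. \<forall>n \<alpha>. \<Xi> n \<alpha> \<in> calg_tensors n}"
    by (auto simp: pscale_def intro: calg_scale)
  assume y: "y \<in> {\<Xi>. \<forall>n \<alpha>. \<Xi> n \<alpha> \<in> calg_tensors n}"
  have "(x + y) n \<alpha> = x n \<alpha> + y n \<alpha>" for n \<alpha> by simp
  then show "x + y \<in> {\<Xi>. \<forall>n \<alpha>. \<Xi> n \<alpha> \<in> calg_tensors n}"
    using x y calg_add by (simp only: mem_Collect_eq) blast
next
  have "(0 :: 'a ptensor) n \<alpha> = 0" for n \<alpha> by simp
  then show "(0 :: 'a ptensor) \<in> {\<Xi>. \<forall>n \<alpha>. \<Xi> n \<alpha> \<in> calg_tensors n}"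
    using calg_0 by (simp only: mem_Collect_eq) blast
qed

lemma TP_calg:
  assumes "\<Xi> \<in> TP"
  shows "\<Xi> n \<alpha> \<in> calg_tensors n"
proof -
  have "TP \<subseteq> {\<Xi> :: 'a ptensor. \<forall>n \<alpha>. \<Xi> n \<alpha> \<in> calg_tensors n}"
    unfolding TP_def using calg_sym_pure ralg_subset_calg
    by (intro pt.span_minimal subspace_calg_coeffs) blast
  then show ?thesis using assms by blast
qed

lemma calg_cup_prod:
  assumes "\<Xi> \<in> TP" "\<Theta> \<in> TP"
  shows "cup_prod \<Xi> \<Theta> m \<gamma> \<in> calg_tensors m"
  unfolding cup_prod_def ptensor_sum_apply
  by (intro calg_sum calg_sym_pure calg_tprod TP_calg[OF assms(1)] TP_calg[OF assms(2)])

lemma calg_inv_conj: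
  assumes "\<Xi> \<in> TP"
  shows "inv_conj \<Xi> m \<gamma> \<in> calg_tensors m"
  using calg_cnj[OF TP_calg[OF assms, of m "inv \<gamma>"]] calg_0[of m]
  unfolding inv_conj_def by (simp only: split: if_split) blast

lemma sym_pure_TP:
  assumes "F \<in> calg_tensors n" "\<alpha> \<in> Sym0 n"
  shows "sym_pure n \<alpha> F \<in> TP"
  using assms(1)
proof (induction rule: calg_induct)
  case zero
  show ?case unfolding sym_pure_0 by (rule TP_0)
next
  case (add c hs F)
  have "sym_pure n \<alpha> (simple_tensor hs) \<in> TP"
    unfolding TP_def using assms(2) add.hyps(1)
    by (intro pt.span_base) (auto simp: ralg_tensors_def intro!: rtens.span_base)
  then show ?case
    unfolding sym_pure_add sym_pure_scale by (intro TP_add TP_scale add.IH)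
qed

text \<open>The generators are eigenvectors of \<open>R\<close>, so \<open>R\<close> preserves their span; being an involution, it
  maps the span onto itself.\<close>

lemma Rmap_image_span:
  assumes "\<And>n \<alpha> F. (n, \<alpha>, F) \<in> D \<Longrightarrow> \<alpha> \<in> Sym0 n"
  defines "V \<equiv> pt.span {sym_pure n \<alpha> F |n \<alpha> F. (n, \<alpha>, F) \<in> D}"
  shows "Rmap ` V = V"
proof -
  have sub: "Rmap X \<in> V" if "X \<in> V" for X
    using that unfolding V_def
  proof (induction rule: pt.span_induct_alt)
    case base
    show ?case unfolding Rmap_0 by (rule pt.span_zero)
  next
    case (step c x y)
    then obtain n \<alpha> F where x: "x = sym_pure n \<alpha> F" "(n, \<alpha>, F) \<in> D" by blast
    show ?case
      unfolding Rmap_add Rmap_pscale x(1) Rmap_sym_pure[OF assms(1)[OF x(2)]]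
      using x(2) step.IH by (intro pt.span_add pt.span_scale) (auto intro: pt.span_base)
  qed
  then have "X \<in> Rmap ` V" if "X \<in> V" for X
    using that Rmap_Rmap[of X] by (metis imageI)
  then show ?thesis using sub by blast
qed

lemma Rmap_TP: "Rmap ` TP = (TP :: 'h::real_inner ptensor set)"
  using Rmap_image_span[of "{(n, \<alpha>, F :: 'h tensor). \<alpha> \<in> Sym0 n \<and> F \<in> ralg_tensors n}"]
  by (simp add: TP_def)

lemma Rmap_pre_fock: "Rmap ` pre_fock = (pre_fock :: 'h::real_inner ptensor set)"
  using Rmap_image_span[of "{(n, \<alpha>, F :: 'h tensor). \<alpha> \<in> Sym0 n \<and> F \<in> hs_tensors n}"]
  by (simp add: pre_fock_def)

lemma TP_finite_support:
  assumes "\<Xi> \<in> TP"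
  shows "finite {n. \<Xi> n \<noteq> 0}"
  using assms unfolding TP_def
proof (induction rule: pt.span_induct_alt)
  case base
  have "{n. (0 :: 'a ptensor) n \<noteq> 0} = {}" by simp
  then show ?case by (simp only: finite.emptyI)
next
  case (step c x y)
  then obtain k \<alpha> F where x: "x = sym_pure k \<alpha> F" by blast
  have "(pscale c x + y) n = 0" if "n \<noteq> k" "y n = 0" for n
    unfolding x using that sym_pure_degree'[OF that(1), of \<alpha> F]
    by (intro ext) (simp add: pscale_def tscale_def)
  then have "{n. (pscale c x + y) n \<noteq> 0} \<subseteq> insert k {n. y n \<noteq> 0}" by blast
  then show ?case using step.IH finite_subset by blast
qed

lemma bij_betw_comp_right_Sym1:
  assumes "\<sigma> \<in> Sym1 n"
  shows "bij_betw (\<lambda>\<tau>. \<tau> \<circ> \<sigma>) (Sym1 n) (Sym1 n)"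
proof (rule bij_betw_byWitness[where f' = "\<lambda>\<tau>. \<tau> \<circ> inv \<sigma>"])
  have s: "\<sigma> permutes {1..n}" using assms by (simp add: Sym1_def)
  show "\<forall>\<tau>\<in>Sym1 n. \<tau> \<circ> \<sigma> \<circ> inv \<sigma> = \<tau>" "\<forall>\<tau>\<in>Sym1 n. \<tau> \<circ> inv \<sigma> \<circ> \<sigma> = \<tau>"
    using permutes_inv_o[OF s] by (simp_all add: comp_assoc)
  show "(\<lambda>\<tau>. \<tau> \<circ> \<sigma>) ` Sym1 n \<subseteq> Sym1 n" "(\<lambda>\<tau>. \<tau> \<circ> inv \<sigma>) ` Sym1 n \<subseteq> Sym1 n"
    using s permutes_inv[OF s] by (auto simp: Sym1_def intro: permutes_compose)
qed

text \<open>Averaging over the group forgets a simultaneous conjugation, by the substitution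
  \<open>\<tau> \<mapsto> \<tau>\<sigma>\<close>.\<close>

lemma sym_pure_conj:
  assumes F: "F \<in> calg_tensors n" and s: "\<sigma> \<in> Sym1 n"
  shows "sym_pure n (\<sigma> \<circ> \<alpha> \<circ> inv \<sigma>) (tperm \<sigma> F) = sym_pure n \<alpha> F"
proof -
  let ?g = "\<lambda>\<tau>. pure n (\<tau> \<circ> \<alpha> \<circ> inv \<tau>) (tperm \<tau> F)"
  have "pure n (\<tau> \<circ> (\<sigma> \<circ> \<alpha> \<circ> inv \<sigma>) \<circ> inv \<tau>) (tperm \<tau> (tperm \<sigma> F)) = ?g (\<tau> \<circ> \<sigma>)"
    if "\<tau> \<in> Sym1 n" for \<tau>
  proof -
    have "bij \<tau>" "bij \<sigma>" using that s by (auto simp: Sym1_def permutes_bij)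
    then have "\<tau> \<circ> (\<sigma> \<circ> \<alpha> \<circ> inv \<sigma>) \<circ> inv \<tau> = (\<tau> \<circ> \<sigma>) \<circ> \<alpha> \<circ> inv (\<tau> \<circ> \<sigma>)"
      by (simp add: o_inv_distrib comp_assoc)
    then show ?thesis unfolding tperm_comp[OF F s] by (simp only:)
  qed
  then have "(\<Sum>\<tau>\<in>Sym1 n. pure n (\<tau> \<circ> (\<sigma> \<circ> \<alpha> \<circ> inv \<sigma>) \<circ> inv \<tau>) (tperm \<tau> (tperm \<sigma> F))) =
      (\<Sum>\<tau>\<in>Sym1 n. ?g (\<tau> \<circ> \<sigma>))"
    by (intro sum.cong refl)
  also have "\<dots> = (\<Sum>\<tau>\<in>Sym1 n. ?g \<tau>)"
    by (rule sum.reindex_bij_betw[OF bij_betw_comp_right_Sym1[OF s]])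
  finally show ?thesis unfolding sym_pure_def by (simp only:)
qed

lemma sum_sym_pure_pure:
  assumes "\<gamma> \<in> Sym0 n"
  shows "(\<Sum>\<alpha>\<in>Sym0 n. sym_pure n \<alpha> (pure n \<gamma> G n \<alpha>)) = sym_pure n \<gamma> G"
proof -
  have "(\<Sum>\<alpha>\<in>Sym0 n. sym_pure n \<alpha> (pure n \<gamma> G n \<alpha>)) =
      (\<Sum>\<alpha>\<in>Sym0 n. if \<alpha> = \<gamma> then sym_pure n \<gamma> G else 0)"
    by (intro sum.cong refl) (auto simp: pure_def sym_pure_0[unfolded zero_fun_def])
  also have "\<dots> = sym_pure n \<gamma> G" using assms by (simp only: sum.delta' sum.delta finite_Sym0 if_True)
  finally show ?thesis .
qed

text \<open>The degree-\<open>n\<close> contribution of the trivial contraction to \<open>T\<^sup>(\<^sup>q\<^sup>)\<close>.\<close>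

definition symmetrize :: "nat \<Rightarrow> 'h ptensor \<Rightarrow> 'h ptensor" where
  "symmetrize n \<Xi> = (\<Sum>\<alpha>\<in>Sym0 n. sym_pure n \<alpha> (\<Xi> n \<alpha>))"

lemma symmetrize_add: "symmetrize n (\<Xi> + \<Theta>) = symmetrize n \<Xi> + symmetrize n \<Theta>"
proof -
  have "(\<Xi> + \<Theta>) n \<alpha> = \<Xi> n \<alpha> + \<Theta> n \<alpha>" for \<alpha> by simp
  then show ?thesis unfolding symmetrize_def by (simp only: sym_pure_add sum.distrib)
qed

lemma symmetrize_scale: "symmetrize n (pscale c \<Xi>) = pscale c (symmetrize n \<Xi>)"
  unfolding symmetrize_def by (simp only: pscale_def[of c \<Xi>] sym_pure_scale pt.scale_sum_right)

lemma symmetrize_0: "symmetrize n 0 = 0"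
  using symmetrize_scale[of n 0 0] by (simp only: pt.scale_zero_left)

lemma symmetrize_sum: "symmetrize n (\<Sum>k\<in>A. f k) = (\<Sum>k\<in>A. symmetrize n (f k))"
  by (induction A rule: infinite_finite_induct)
    (simp_all only: sum.infinite sum.empty sum.insert symmetrize_0 symmetrize_add not_False_eq_True)

lemma symmetrize_sym_pure:
  assumes F: "F \<in> calg_tensors n" and a: "\<alpha> \<in> Sym0 n"
  shows "symmetrize n (sym_pure n \<alpha> F) = sym_pure n \<alpha> F"
proof -
  have "symmetrize n (pure n (\<sigma> \<circ> \<alpha> \<circ> inv \<sigma>) (tperm \<sigma> F)) = sym_pure n \<alpha> F" if s: "\<sigma> \<in> Sym1 n" for \<sigma>
    unfolding symmetrize_def sum_sym_pure_pure[OF Sym0_conj[OF a s]] sym_pure_conj[OF F s] by (rule refl)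
  then have "symmetrize n (sym_pure n \<alpha> F) = pscale (1 / fact n) (\<Sum>\<sigma>\<in>Sym1 n. sym_pure n \<alpha> F)"
    unfolding sym_pure_def[of n \<alpha> F] symmetrize_scale symmetrize_sum
    by (simp only: sym_pure_def[of n \<alpha> F] cong: sum.cong)
  also have "(\<Sum>\<sigma>\<in>Sym1 n. sym_pure n \<alpha> F) = pscale (fact n) (sym_pure n \<alpha> F)"
  proof -
    have "card (Sym1 n) = fact n" unfolding Sym1_def by (rule card_permutations) auto
    then show ?thesis by (simp only: pt.sum_constant_scale of_nat_fact)
  qed
  finally show ?thesis by (simp add: pt.scale_scale)
qed

text \<open>Elements of \<^const>\<open>TP\<close> are already symmetric, so symmetrizing their coefficients only projects
  to degree \<open>n\<close>. This identifies the leading term of \<open>T\<^sup>(\<^sup>q\<^sup>)\<close> as the identity.\<close>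

lemma symmetrize_TP:
  assumes "\<Xi> \<in> TP"
  shows "symmetrize n \<Xi> m = (if m = n then \<Xi> m else 0)"
  using assms unfolding TP_def
proof (induction rule: pt.span_induct_alt)
  case base
  show ?case unfolding symmetrize_0 by simp
next
  case (step c x y)
  then obtain k \<alpha> F where x: "x = sym_pure k \<alpha> F" "\<alpha> \<in> Sym0 k" "F \<in> calg_tensors k"
    using ralg_subset_calg by blast
  have "symmetrize n x m = (if m = n then x m else 0)"
  proof (cases "n = k")
    case True
    then show ?thesis
      unfolding x(1) using symmetrize_sym_pure[OF x(3,2)] sym_pure_degree'[of m k \<alpha> F] by simp
  next
    case False
    have "symmetrize n x = 0"
      unfolding symmetrize_def x(1) sym_pure_degree[OF False] sym_pure_0 by simp
    then show ?thesis unfolding x(1) using sym_pure_degree'[OF False, of \<alpha> F] by simp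
  qed
  then show ?case unfolding symmetrize_add symmetrize_scale using step.IH
    by (simp add: pscale_def[of c] fun_eq_iff tscale_def)
qed

section \<open>Bijectivity of the Wick map and the isomorphism\<close>

definition Tpart :: "real \<Rightarrow> nat \<Rightarrow> 'h::real_inner ptensor \<Rightarrow> 'h ptensor" where
  "Tpart q n \<Xi> = (\<Sum>\<alpha>\<in>Sym0 n. \<Sum>\<pi>\<in>P12 n.
      pscale (complex_of_real (contr_coeff q n \<pi> \<alpha>))
        (sym_pure (n - 2 * npairs \<pi>) (contr_perm \<pi> \<alpha>) (contr n \<pi> (\<Xi> n \<alpha>))))"

lemma Tmap_superset:
  assumes "finite N" "{n. \<Xi> n \<noteq> 0} \<subseteq> N"
  shows "Tmap q \<Xi> = (\<Sum>n\<in>N. Tpart q n \<Xi>)"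
  unfolding Tmap_def Tpart_def[symmetric]
proof (rule sum.mono_neutral_left[OF assms], rule ballI)
  fix n assume "n \<in> N - {n. \<Xi> n \<noteq> 0}"
  then have "\<Xi> n = 0" by blast
  then have "\<Xi> n \<alpha> = 0" for \<alpha> by simp
  then show "Tpart q n \<Xi> = 0"
    unfolding Tpart_def
    by (simp only: contr_0 sym_pure_0 pt.scale_zero_right sum.neutral_const cong: sum.cong)
qed

lemma Tpart_add:
  assumes "\<Xi> \<in> TP" "\<Theta> \<in> TP"
  shows "Tpart q n (\<Xi> + \<Theta>) = Tpart q n \<Xi> + Tpart q n \<Theta>"
proof -
  have "contr n \<pi> ((\<Xi> + \<Theta>) n \<alpha>) = contr n \<pi> (\<Xi> n \<alpha>) + contr n \<pi> (\<Theta> n \<alpha>)" if "\<pi> \<in> P12 n" for \<pi> \<alpha>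
  proof -
    have "(\<Xi> + \<Theta>) n \<alpha> = \<Xi> n \<alpha> + \<Theta> n \<alpha>" by simp
    then show ?thesis by (simp only: contr_add[OF that TP_calg[OF assms(1)] TP_calg[OF assms(2)]])
  qed
  then show ?thesis
    unfolding Tpart_def
    by (simp only: sym_pure_add pt.scale_right_distrib sum.distrib cong: sum.cong)
qed

lemma Tmap_add:
  assumes "\<Xi> \<in> TP" "\<Theta> \<in> TP"
  shows "Tmap q (\<Xi> + \<Theta>) = Tmap q \<Xi> + Tmap q \<Theta>"
proof -
  let ?N = "{n. \<Xi> n \<noteq> 0} \<union> {n. \<Theta> n \<noteq> 0}"
  have fin: "finite ?N" using assms by (simp add: TP_finite_support)
  have "(\<Xi> + \<Theta>) n = 0" if "\<Xi> n = 0" "\<Theta> n = 0" for n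
    using that by (intro ext) simp
  then have "{n. (\<Xi> + \<Theta>) n \<noteq> 0} \<subseteq> ?N" by blast
  then show ?thesis
    using Tmap_superset[OF fin, of "\<Xi> + \<Theta>" q] Tmap_superset[OF fin, of \<Xi> q] Tmap_superset[OF fin, of \<Theta> q]
    by (simp only: Tpart_add[OF assms] sum.distrib Un_upper1 Un_upper2)
qed

lemma Tmap_TP:
  assumes "\<Xi> \<in> TP"
  shows "Tmap q \<Xi> \<in> TP"
  unfolding Tmap_def
  by (intro TP_sum TP_scale sym_pure_TP contr_perm_Sym0 calg_contr TP_calg[OF assms])

lemma enumerate_UNIV: "enumerate UNIV n = (n :: nat)"
proof (induction n)
  case 0
  show ?case by (simp add: enumerate_0)
next
  case (Suc n)
  have "enumerate UNIV (Suc n) = (LEAST s. s \<in> UNIV \<and> enumerate UNIV n < (s :: nat))"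
    by (rule enumerate_Suc'') simp
  also have "\<dots> = Suc n" unfolding Suc.IH by (intro Least_equality) auto
  finally show ?case .
qed

lemma contr_perm_coeff_id: "contr_perm id \<alpha> = \<alpha>" "contr_coeff q n id \<alpha> = 1"
proof -
  have "(LEAST j::nat. 0 < j) = 1" by (rule Least_equality) auto
  then have r: "restrict_perm {} \<alpha> = \<alpha>" by (auto simp: restrict_perm_def)
  have p: "psupp id = {}" by (simp add: psupp_def)
  have e: "enumerate UNIV = (id :: nat \<Rightarrow> nat)" using enumerate_UNIV by (auto simp: fun_eq_iff)
  show "contr_perm id \<alpha> = \<alpha>" by (simp add: contr_perm_def p r relabel_def e)
  show "contr_coeff q n id \<alpha> = 1" by (simp add: contr_coeff_def p r npairs_def)
qed

lemma npairs_pos: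
  assumes "\<pi> \<in> P12 n" "\<pi> \<noteq> id"
  shows "0 < npairs \<pi>"
proof -
  note P = P12_properties[OF assms(1)]
  have "psupp \<pi> \<noteq> {}" using assms(2) by (auto simp: psupp_def fun_eq_iff)
  then have "0 < card (psupp \<pi>)" using P(4) finite_subset by (auto simp: card_gt_0_iff)
  then show ?thesis using P(3) by simp
qed

lemma pscale_degree: "X m = 0 \<Longrightarrow> pscale c X m = 0"
  by (intro ext) (simp add: pscale_def tscale_def)

lemma ptensor_sum_degree: "(\<Sum>k\<in>A. f k) m = (\<Sum>k\<in>A. f k m)" for f :: "'a \<Rightarrow> 'h ptensor"
  by (rule sum_fun_apply)

text \<open>A contraction with at least one pair lowers the degree, so in the degrees from \<open>n\<close> upwards only
  the trivial one is seen.\<close>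

lemma Tpart_top:
  assumes X: "\<Xi> \<in> TP" and m: "n \<le> m"
  shows "Tpart q n \<Xi> m = symmetrize n \<Xi> m"
proof -
  have "(\<Sum>\<pi>\<in>P12 n. pscale (complex_of_real (contr_coeff q n \<pi> \<alpha>))
        (sym_pure (n - 2 * npairs \<pi>) (contr_perm \<pi> \<alpha>) (contr n \<pi> (\<Xi> n \<alpha>))) m) =
      sym_pure n \<alpha> (\<Xi> n \<alpha>) m" (is "sum ?f _ = _") for \<alpha>
  proof -
    have "?f \<pi> = 0" if "\<pi> \<in> P12 n - {id}" for \<pi>
    proof -
      have "0 < npairs \<pi>" using that by (intro npairs_pos) auto
      moreover have "2 * npairs \<pi> \<le> n" using that npairs_le by blast
      ultimately have "m \<noteq> n - 2 * npairs \<pi>" using m by linarith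
      then show ?thesis by (intro pscale_degree sym_pure_degree')
    qed
    then have "sum ?f (P12 n - {id}) = 0" by (intro sum.neutral ballI)
    then have "sum ?f (P12 n) = ?f id"
      by (simp only: sum.remove[OF finite_P12 id_P12] add_0_right)
    also have "\<dots> = sym_pure n \<alpha> (\<Xi> n \<alpha>) m"
      unfolding contr_perm_coeff_id contr_id[OF TP_calg[OF X]] by (simp add: npairs_def)
    finally show ?thesis .
  qed
  then show ?thesis
    unfolding Tpart_def symmetrize_def ptensor_sum_degree by (simp only:)
qed

lemma Tmap_top:
  assumes X: "\<Xi> \<in> TP" and d: "\<And>n. d < n \<Longrightarrow> \<Xi> n = 0" and m: "d \<le> m"
  shows "Tmap q \<Xi> m = \<Xi> m"
proof -
  have N: "{n. \<Xi> n \<noteq> 0} \<subseteq> {..m}" using d m by (force simp: not_le[symmetric])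
  have "Tmap q \<Xi> m = (\<Sum>n\<le>m. Tpart q n \<Xi> m)"
    by (simp only: Tmap_superset[OF finite_atMost N] ptensor_sum_degree)
  also have "\<dots> = (\<Sum>n\<le>m. if n = m then \<Xi> m else 0)"
    by (intro sum.cong refl) (auto simp only: Tpart_top[OF X] symmetrize_TP[OF X] atMost_iff split: if_split)
  also have "\<dots> = \<Xi> m" by (simp only: sum.delta finite_atMost atMost_iff order.refl if_True)
  finally show ?thesis .
qed

text \<open>\<open>T\<^sup>(\<^sup>q\<^sup>)\<close> is unitriangular for the filtration by degree, hence it cannot kill the top component of
  a nonzero element.\<close>

lemma inj_on_Tmap: "inj_on (Tmap q) TP"
proof (rule inj_onI)
  fix X Y :: "'a ptensor"
  assume XY: "X \<in> TP" "Y \<in> TP" "Tmap q X = Tmap q Y"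
  define Z where "Z = X - Y"
  have Z: "Z \<in> TP" unfolding Z_def by (intro TP_diff XY)
  have "Tmap q X = Tmap q (Y + Z)" unfolding Z_def by (simp only: add_diff_eq add_diff_cancel_left')
  then have TZ: "Tmap q Z = 0"
    unfolding Tmap_add[OF XY(2) Z] XY(3) by (simp only: add_cancel_right_right)
  have "{n. Z n \<noteq> 0} = {}"
  proof (rule ccontr)
    assume ne: "{n. Z n \<noteq> 0} \<noteq> {}"
    let ?d = "Max {n. Z n \<noteq> 0}"
    have fin: "finite {n. Z n \<noteq> 0}" by (rule TP_finite_support[OF Z])
    have "Z n = 0" if "?d < n" for n
    proof (rule ccontr)
      assume "Z n \<noteq> 0"
      then have "n \<le> ?d" by (intro Max_ge[OF fin] CollectI)
      then show False using that by (rule leD[THEN notE])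
    qed
    then have "Tmap q Z ?d = Z ?d" by (rule Tmap_top[OF Z _ order.refl])
    then have "Z ?d = 0" unfolding TZ by simp
    then show False using Max_in[OF fin ne] by blast
  qed
  then have "Z = 0" by (intro ext) auto
  then show "X = Y" unfolding Z_def by (simp only: right_minus_eq)
qed

text \<open>The other half of unitriangularity: \<open>X - T\<^sup>(\<^sup>q\<^sup>) X\<close> has smaller degree than \<open>X\<close>, hence is in the image
  by induction, and then so is \<open>X\<close>.\<close>

lemma Tmap_surj:
  assumes "X \<in> TP"
  shows "\<exists>Y\<in>TP. Tmap q Y = X"
proof -
  have "\<exists>Y\<in>TP. Tmap q Y = X" if "X \<in> TP" "\<forall>n\<ge>d. X n = 0" for X :: "'a ptensor" and d
    using that
  proof (induction d arbitrary: X)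
    case 0
    then have "X = 0" by (intro ext) auto
    moreover have "Tmap q (0 :: 'a ptensor) = 0" by (simp add: Tmap_def)
    ultimately show ?case using TP_0 by blast
  next
    case (Suc d)
    let ?Z = "X - Tmap q X"
    have Z: "?Z \<in> TP" by (intro TP_diff Tmap_TP Suc.prems)
    have "?Z n = 0" if "d \<le> n" for n
    proof -
      have "Tmap q X n = X n"
        using Suc.prems(2) by (intro Tmap_top[OF Suc.prems(1) _ that]) (blast intro: Suc_leI)
      moreover have "?Z n = X n - Tmap q X n" by (rule fun_diff_def[THEN fun_cong])
      ultimately show ?thesis by (simp only: diff_self)
    qed
    then have "\<forall>n\<ge>d. ?Z n = 0" by blast
    from Suc.IH[OF Z this] obtain Y where Y: "Y \<in> TP" "Tmap q Y = ?Z" by blast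
    have "Tmap q (X + Y) = X"
      unfolding Tmap_add[OF Suc.prems(1) Y(1)] Y(2) by (simp only: add_diff_cancel_left' add_diff_eq)
    then show ?case using TP_add[OF Suc.prems(1) Y(1)] by blast
  qed
  moreover obtain d where "\<forall>n\<ge>d. X n = 0"
    using TP_finite_support[OF assms] unfolding finite_nat_set_iff_bounded
    by (blast dest: leD)
  ultimately show ?thesis using assms by blast
qed

lemma inv_Tmap:
  assumes "X \<in> TP"
  shows "inv_into TP (Tmap q) X \<in> TP" "Tmap q (inv_into TP (Tmap q) X) = X"
  using Tmap_surj[OF assms, of q] by (metis image_eqI inv_into_into, metis f_inv_into_f image_eqI)

text \<open>Bijectivity of both maps is what lets the intertwining relation pass to the inverses, which occur
  in the definitions of the product and of the adjoint.\<close>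

lemma inv_Tmap_Rmap:
  assumes X: "X \<in> TP"
  shows "inv_into TP (Tmap (- q)) (Rmap X) = Rmap (inv_into TP (Tmap q) X)"
proof -
  let ?x = "inv_into TP (Tmap q) X"
  note x = inv_Tmap[OF X, of q]
  have "Tmap (- q) (Rmap ?x) = Rmap X"
    using Rmap_Tmap[of ?x q, OF TP_calg[OF x(1)]] unfolding x(2) by (rule sym)
  moreover have "Rmap ?x \<in> TP" using x(1) Rmap_TP by blast
  ultimately show ?thesis using inv_into_f_f[OF inj_on_Tmap] by metis
qed

lemma Rmap_qmult:
  assumes "X \<in> TP" "Y \<in> TP"
  shows "Rmap (qmult q X Y) = qmult (- q) (Rmap X) (Rmap Y)"
  unfolding qmult_def inv_Tmap_Rmap[OF assms(1)] inv_Tmap_Rmap[OF assms(2)] Rmap_cup_prod[symmetric]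
  by (intro Rmap_Tmap calg_cup_prod inv_Tmap assms)

lemma Rmap_qadj:
  assumes "X \<in> TP"
  shows "Rmap (qadj q X) = qadj (- q) (Rmap X)"
  unfolding qadj_def inv_Tmap_Rmap[OF assms] Rmap_inv_conj[symmetric]
  by (intro Rmap_Tmap calg_inv_conj inv_Tmap assms)

lemma star_isomorphism_Rmap:
  "star_isomorphism TP (qmult q) (qadj q) TP (qmult (- q)) (qadj (- q)) Rmap"
  unfolding star_isomorphism_def
proof (intro conjI ballI allI)
  show "bij_betw Rmap TP TP"
    by (rule bij_betw_byWitness[where f' = Rmap]) (simp_all add: Rmap_Rmap Rmap_TP)
qed (simp_all only: Rmap_add Rmap_pscale Rmap_qmult Rmap_qadj)

section \<open>The Fock space isometry\<close>

lemma chi_minus: "\<gamma> \<in> Sym0 n \<Longrightarrow> chi (- q) n \<gamma> = of_int (sign \<gamma>) * chi q n \<gamma>"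
  unfolding chi_def power_minus[of q] by (simp only: minus_one_power_plen)

lemma tinner_scale:
  "tinner n (tscale (of_int a) F) (tscale (of_int b) G) = of_int a * of_int b * tinner n F G"
proof -
  have "tinner n (tscale (of_int a) F) (tscale (of_int b) G) =
      (\<Sum>\<^sub>\<infinity>bs\<in>onb_lists n. (of_int a * of_int b) * (cnj (F bs) * G bs))"
    by (simp add: tinner_def tscale_def mult_ac)
  then show ?thesis by (simp only: tinner_def infsum_cmult_right')
qed

text \<open>The sign of \<open>\<alpha> \<sigma> \<beta>\<^sup>-\<^sup>1 \<sigma>\<^sup>-\<^sup>1\<close> is \<open>sign \<alpha> \<cdot> sign \<beta>\<close>. This is the factor between \<open>\<chi>\<^sub>-\<^sub>q\<close> and \<open>\<chi>\<^sub>q\<close>,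
  and also the factor that the two applications of \<open>R\<close> take out of the inner product.\<close>

lemma fock_form_Rmap: "fock_form (- q) (Rmap \<Xi>) (Rmap \<Theta>) = fock_form q \<Xi> \<Theta>"
  unfolding fock_form_def Rmap_nonzero
proof (intro sum.cong refl)
  fix n \<alpha> \<beta> \<sigma>
  assume a: "\<alpha> \<in> Sym0 n" and b: "\<beta> \<in> Sym0 n" and s: "\<sigma> \<in> Sym1 n"
  note s' = Sym1_subset_Sym0[OF s]
  let ?\<gamma> = "\<alpha> \<circ> \<sigma> \<circ> inv \<beta> \<circ> inv \<sigma>"
  have g: "?\<gamma> \<in> Sym0 n" by (intro Sym0_comp Sym0_inv a b s')
  have "sign ?\<gamma> = sign \<alpha> * sign \<sigma> * sign \<beta> * sign \<sigma>"
    by (simp add: sign_comp[of _ n] Sym0_comp Sym0_inv sign_inv[of _ n] a b s')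
  then have "of_int (sign ?\<gamma>) = (of_int (sign \<alpha> * sign \<beta>) :: real)"
    by (simp add: mult.assoc mult.left_commute)
  moreover have "(of_int (sign \<alpha>) * of_int (sign \<beta>)) * (of_int (sign \<alpha>) * of_int (sign \<beta>)) = (1 :: complex)"
    by (simp flip: of_int_mult) (simp add: mult_ac)
  ultimately show "complex_of_real (chi (- q) n ?\<gamma>) * tinner n (Rmap \<Xi> n \<alpha>) (tperm \<sigma> (Rmap \<Theta> n \<beta>)) =
      complex_of_real (chi q n ?\<gamma>) * tinner n (\<Xi> n \<alpha>) (tperm \<sigma> (\<Theta> n \<beta>))"
    unfolding chi_minus[OF g] Rmap_apply[OF a] Rmap_apply[OF b] tperm_scale tinner_scale
    by (simp add: mult_ac)
qed

text \<open>The completion and its operations are built from Cauchy sequences in \<open>V\<close>, using nothing but the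
  vector space operations and the form. A linear bijection that respects the form therefore carries
  them over when it is applied to the terms of the sequences, and \<open>\<Phi>\<close> is the resulting map on
  classes.\<close>

lemma induces_isometry_ontoI:
  fixes V V' :: "'h::real_inner ptensor set"
  assumes V: "pt.subspace V" and f: "bij_betw f V V'"
    and add: "\<And>x y. x \<in> V \<Longrightarrow> y \<in> V \<Longrightarrow> f (x + y) = f x + f y"
    and scale: "\<And>c x. x \<in> V \<Longrightarrow> f (pscale c x) = pscale c (f x)"
    and form: "\<And>x y. x \<in> V \<Longrightarrow> y \<in> V \<Longrightarrow> s' (f x) (f y) = s x y"
  shows "induces_isometry_onto V s V' s' f"
proof -
  define F where "F X k = f (X k)" for X :: "nat \<Rightarrow> 'h ptensor" and k :: nat
  define \<Phi> where "\<Phi> C = F ` C" for C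
  note fV = bij_betw_imp_surj_on[OF f]
  have diff: "f (x - y) = f x - f y" if "x \<in> V" "y \<in> V" for x y
  proof -
    have "f (x - y) + f y = f x"
      using add[OF pt.subspace_diff[OF V that] that(2)] by (simp only: diff_add_cancel)
    then show ?thesis by (simp only: eq_diff_eq)
  qed
  have norm: "form_norm s' (f x - f y) = form_norm s (x - y)" if "x \<in> V" "y \<in> V" for x y
    unfolding form_norm_def diff[OF that, symmetric]
    using form pt.subspace_diff[OF V that] by (simp only:)
  have cauchy: "F X \<in> cauchy_seqs V' s' \<longleftrightarrow> X \<in> cauchy_seqs V s" if X: "range X \<subseteq> V" for X
  proof -
    have Xk: "X k \<in> V" for k using X by blast
    then have "range (F X) \<subseteq> V'" using fV by (auto simp: F_def)
    then show ?thesis unfolding cauchy_seqs_def using X by (simp add: F_def norm[OF Xk Xk])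
  qed
  have null: "(F X, F Y) \<in> null_rel V' s' \<longleftrightarrow> (X, Y) \<in> null_rel V s"
    if X: "range X \<subseteq> V" and Y: "range Y \<subseteq> V" for X Y
  proof -
    have k: "X k \<in> V" "Y k \<in> V" for k using X Y by blast+
    show ?thesis unfolding null_rel_def by (simp add: cauchy X Y) (simp add: F_def norm[OF k])
  qed
  have range: "range X \<subseteq> V" if "X \<in> cauchy_seqs V s" for X
    using that by (simp add: cauchy_seqs_def)
  have lift: "\<exists>X. range X \<subseteq> V \<and> Y = F X" if "range Y \<subseteq> V'" for Y
  proof (intro exI conjI)
    have "Y k \<in> f ` V" for k using that fV by blast
    then show "range (\<lambda>k. inv_into V f (Y k)) \<subseteq> V" "Y = F (\<lambda>k. inv_into V f (Y k))"
      by (auto simp: F_def f_inv_into_f intro: inv_into_into)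
  qed
  have cauchy_img: "cauchy_seqs V' s' = F ` cauchy_seqs V s"
  proof (intro equalityI subsetI)
    fix Y assume Y: "Y \<in> cauchy_seqs V' s'"
    then have "range Y \<subseteq> V'" by (simp add: cauchy_seqs_def)
    then obtain X where "range X \<subseteq> V" "Y = F X" using lift by blast
    then show "Y \<in> F ` cauchy_seqs V s" using Y cauchy by blast
  qed (use cauchy range in blast)
  have cls: "null_rel V' s' `` {F X} = \<Phi> (null_rel V s `` {X})" if X: "range X \<subseteq> V" for X
  proof (intro equalityI subsetI)
    fix Y assume Y: "Y \<in> null_rel V' s' `` {F X}"
    then have "Y \<in> cauchy_seqs V' s'" by (simp add: null_rel_def)
    then obtain Z where Z: "Z \<in> cauchy_seqs V s" "Y = F Z" using cauchy_img by blast
    then show "Y \<in> \<Phi> (null_rel V s `` {X})" using Y null[OF X range] by (auto simp: \<Phi>_def)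
  next
    fix Y assume "Y \<in> \<Phi> (null_rel V s `` {X})"
    then obtain Z where Z: "(X, Z) \<in> null_rel V s" "Y = F Z" by (auto simp: \<Phi>_def)
    then have "range Z \<subseteq> V" using range by (simp add: null_rel_def)
    then show "Y \<in> null_rel V' s' `` {F X}" using Z null[OF X] by simp
  qed
  have mem: "range X \<subseteq> V" if "C \<in> hcompl V s" "X \<in> C" for C X
    using that range by (auto simp: hcompl_def null_rel_def elim!: quotientE)
  have surj: "\<Phi> ` hcompl V s = hcompl V' s'"
    unfolding hcompl_def quotient_def cauchy_img using cls range by (simp add: image_UN)
  have hadd: "\<Phi> (hadd V s C D) = hadd V' s' (\<Phi> C) (\<Phi> D)"
    if C: "C \<in> hcompl V s" and D: "D \<in> hcompl V s" for C D
  proof -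
    have sum: "null_rel V' s' `` {\<lambda>k. F X k + F Y k} = \<Phi> (null_rel V s `` {\<lambda>k. X k + Y k})"
      if "X \<in> C" "Y \<in> D" for X Y
    proof -
      have k: "X k \<in> V" "Y k \<in> V" for k using mem C D that by blast+
      then have "range (\<lambda>k. X k + Y k) \<subseteq> V" using pt.subspace_add[OF V] by blast
      moreover have "(\<lambda>k. F X k + F Y k) = F (\<lambda>k. X k + Y k)"
        by (rule ext) (simp only: F_def add[OF k])
      ultimately show ?thesis using cls by (simp only:)
    qed
    have "hadd V' s' (\<Phi> C) (\<Phi> D) = (\<Union>X\<in>C. \<Union>Y\<in>D. null_rel V' s' `` {\<lambda>k. F X k + F Y k})"
      unfolding hadd_def \<Phi>_def by blast
    also have "\<dots> = (\<Union>X\<in>C. \<Union>Y\<in>D. \<Phi> (null_rel V s `` {\<lambda>k. X k + Y k}))"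
      by (intro SUP_cong refl sum)
    also have "\<dots> = \<Phi> (hadd V s C D)" unfolding hadd_def \<Phi>_def by blast
    finally show ?thesis by (rule sym)
  qed
  have hscale: "\<Phi> (hscale V s c C) = hscale V' s' c (\<Phi> C)" if C: "C \<in> hcompl V s" for c C
  proof -
    have mult: "null_rel V' s' `` {\<lambda>k. pscale c (F X k)} = \<Phi> (null_rel V s `` {\<lambda>k. pscale c (X k)})"
      if "X \<in> C" for X
    proof -
      have k: "X k \<in> V" for k using mem C that by blast
      then have "range (\<lambda>k. pscale c (X k)) \<subseteq> V" using pt.subspace_scale[OF V] by blast
      moreover have "(\<lambda>k. pscale c (F X k)) = F (\<lambda>k. pscale c (X k))"
        by (rule ext) (simp only: F_def scale[OF k])
      ultimately show ?thesis using cls by (simp only:)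
    qed
    have "hscale V' s' c (\<Phi> C) = (\<Union>X\<in>C. null_rel V' s' `` {\<lambda>k. pscale c (F X k)})"
      unfolding hscale_def \<Phi>_def by blast
    also have "\<dots> = (\<Union>X\<in>C. \<Phi> (null_rel V s `` {\<lambda>k. pscale c (X k)}))"
      by (intro SUP_cong refl mult)
    also have "\<dots> = \<Phi> (hscale V s c C)" unfolding hscale_def \<Phi>_def by blast
    finally show ?thesis by (rule sym)
  qed
  have hinner: "hinner s' (\<Phi> C) (\<Phi> D) = hinner s C D"
    if C: "C \<in> hcompl V s" and D: "D \<in> hcompl V s" for C D
  proof -
    have "(\<lambda>k. s' (F X k) (F Y k)) = (\<lambda>k. s (X k) (Y k))" if "X \<in> C" "Y \<in> D" for X Y
    proof
      fix k
      have "X k \<in> V" "Y k \<in> V" using mem C D that by blast+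
      then show "s' (F X k) (F Y k) = s (X k) (Y k)" unfolding F_def by (rule form)
    qed
    then show ?thesis unfolding hinner_def \<Phi>_def by (simp cong: ball_cong)
  qed
  have "isometry_onto V s V' s' \<Phi>"
    unfolding isometry_onto_def by (intro conjI allI ballI surj hadd hscale hinner)
  moreover have "\<forall>v\<in>V. \<Phi> (hembed V s v) = hembed V' s' (f v)"
  proof
    fix v assume "v \<in> V"
    then have "null_rel V' s' `` {F (\<lambda>_. v)} = \<Phi> (null_rel V s `` {\<lambda>_. v})" by (intro cls) auto
    then show "\<Phi> (hembed V s v) = hembed V' s' (f v)"
      unfolding hembed_def F_def[abs_def] by (rule sym)
  qed
  ultimately have "\<exists>\<Phi>. isometry_onto V s V' s' \<Phi> \<and> (\<forall>v\<in>V. \<Phi> (hembed V s v) = hembed V' s' (f v))"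
    by (intro exI[of _ \<Phi>] conjI)
  then show ?thesis
    unfolding induces_isometry_onto_def fV by (intro conjI order.refl)
qed

lemma induces_isometry_onto_Rmap:
  "induces_isometry_onto pre_fock (fock_form q) pre_fock (fock_form (- q)) Rmap"
proof (rule induces_isometry_ontoI)
  show "pt.subspace pre_fock" unfolding pre_fock_def by (rule pt.subspace_span)
  show "bij_betw Rmap pre_fock pre_fock"
    by (rule bij_betw_byWitness[where f' = Rmap]) (simp_all add: Rmap_Rmap Rmap_pre_fock)
qed (simp_all only: Rmap_add Rmap_pscale fock_form_Rmap)

theorem propositionV22:
  fixes q :: real
  assumes "q \<noteq> 0"
  shows
    "(\<forall>n \<alpha>. \<forall>F :: 'h::{real_inner, complete_space} tensor. \<alpha> \<in> Sym0 n \<longrightarrow> F \<in> ralg_tensors n \<longrightarrow>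
        Rmap (sym_pure n \<alpha> F) = pscale ((-1) ^ plen n \<alpha>) (sym_pure n \<alpha> F)) \<and>
     (\<forall>n \<alpha>. \<forall>F :: 'h tensor. \<alpha> \<in> Sym0 n \<longrightarrow> F \<in> ralg_tensors n \<longrightarrow>
        Tmap (- q) (Rmap (sym_pure n \<alpha> F)) = Rmap (Tmap q (sym_pure n \<alpha> F))) \<and>
     star_isomorphism (TP :: 'h ptensor set) (qmult q) (qadj q) TP (qmult (- q)) (qadj (- q)) Rmap \<and>
     (\<forall>n \<alpha>. \<forall>F :: 'h tensor. \<alpha> \<in> Sym0 (2 * n) \<longrightarrow> F \<in> ralg_tensors (2 * n) \<longrightarrow>
        phi (- q) (Rmap (Tmap q (sym_pure (2 * n) \<alpha> F))) = phi q (Tmap q (sym_pure (2 * n) \<alpha> F))) \<and>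
     (\<forall>N::nat. N \<ge> 1 \<longrightarrow>
        induces_isometry_onto (pre_fock :: 'h ptensor set) (fock_form (1 / real N))
          pre_fock (fock_form (- 1 / real N)) Rmap)"
proof (intro conjI allI impI)
  fix n \<alpha> and F :: "'h tensor"
  assume a: "\<alpha> \<in> Sym0 n" and F: "F \<in> ralg_tensors n"
  show "Rmap (sym_pure n \<alpha> F) = pscale ((-1) ^ plen n \<alpha>) (sym_pure n \<alpha> F)"
    unfolding Rmap_sym_pure[OF a] minus_one_power_plen[OF a] by (rule refl)
  show "Tmap (- q) (Rmap (sym_pure n \<alpha> F)) = Rmap (Tmap q (sym_pure n \<alpha> F))"
    using F ralg_subset_calg by (intro Rmap_Tmap[symmetric] calg_sym_pure) blast
next
  \<comment> \<open>The functional only sees degree \<open>0\<close>, where \<open>R\<close> is the identity.\<close>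
  fix n \<alpha> and F :: "'h tensor"
  show "phi (- q) (Rmap (Tmap q (sym_pure (2 * n) \<alpha> F))) = phi q (Tmap q (sym_pure (2 * n) \<alpha> F))"
    by (simp add: phi_def Rmap_def plen_def tscale_def)
next
  fix N :: nat
  show "induces_isometry_onto (pre_fock :: 'h ptensor set) (fock_form (1 / real N))
      pre_fock (fock_form (- 1 / real N)) Rmap"
    using induces_isometry_onto_Rmap[where q = "1 / real N"] by simp
qed (rule star_isomorphism_Rmap)

end
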